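(* Let $P$ be a Fano polygon with singularity content $(n,\mathcal{B})$, with its $n$ primitive $T$-cones numbered $1,\ldots,n$. Let $E_i$ be the edge of $P$ determined by the $i$th primitive $T$-cone and let $w_i\in M$ be the primitive inner normal vector to $E_i$. Let $(B_P,C_P)$ be the initial seed for the cluster algebra $\mathcal{A}_P$, write $B_P=\{e_1,\ldots,e_n\}$ and $C_P=\{x_1,\ldots,x_n\}$, and consider the linear map $\pi\colon L\rightarrow M$ such that $\pi(e_i)=w_i$ for each $i$. Let $(B',C')$ be the $j$th mutation of $(B_P,C_P)$, and write $B'=\{e_1',\ldots,e_n'\}$. Then $\{\pi(e'_1),\ldots,\pi(e'_n)\}$ are (counted with multiplicity) the primitive inner normal vectors to the edges of $P'$ determined by the primitive $T$-cones of $P'$, where $P'$ is the mutation of $P$ determined by $w_j$. Furthermore, every mutation $P'$ of $P$ arises in this way.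
   Context: Let $N\cong\mathbb{Z}^2$, $N_{\mathbb{Q}}=N\otimes_{\mathbb{Z}}\mathbb{Q}$, $M=\operatorname{Hom}(N,\mathbb{Z})$. A Fano polygon is a convex polygon $P\subset N_{\mathbb{Q}}$ whose vertices are primitive lattice points of $N$ and which contains the origin in its strict interior; polygons (and in particular mutations) are considered up to $GL_2(\mathbb{Z})$-equivalence. Singularity content. For an edge $E$ of $P$ with primitive inner normal $w_E\in M$, the height is $r_E=-w_E(E)>0$ and the width is $k_E=|E\cap N|-1$. Write $k_E=n_Er_E+k_0$ with $0\leq k_0<r_E$. The edge can be subdivided into $n_E$ lattice segments of width $r_E$, whose cones are called primitive $T$-cones (each determines the edge $E$; different primitive $T$-cones can determine the same edge), and, if $k_0\neq 0$, one lattice segment of width $k_0$, whose associated cyclic quotient singularity (the residue) is independent of the subdivision. The singularity content of $P$ is $(n,\mathcal{B})$ with $n=\sum_E n_E$ and $\mathcal{B}$ the cyclically ordered list of the residues over all edges with $k_0\neq 0$. Mutation of polygons. Let $w\in M$ be the primitive inner normal vector of an edge $E$ of $P$, let $h_{\min}=\min_{v\in P}w(v)=-r_E<0$ and $h_{\max}=\max_{v\in P}w(v)>0$. For $h\in\mathbb{Z}$ let $w_h(P)$ be the (possibly empty) convex hull of $\{v\in P\cap N: w(v)=h\}$. Let $v_E\in N$ be primitive with $w(v_E)=0$ (unique up to sign) and $F=\operatorname{conv}\{0,v_E\}$. Suppose that for every integer $h$ with $h_{\min}\leq h<0$ there is a (possibly empty) lattice polytope $G_h\subset N_{\mathbb{Q}}$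 with $\{v \text{ a vertex of } P: w(v)=h\}\subseteq G_h+|h|F\subseteq w_h(P)$ (Minkowski sum, with $\varnothing+Q=\varnothing$). Then the mutation of $P$ determined by $w$ is $\operatorname{mut}_w(P,F)=\operatorname{conv}\big(\bigcup_{h=h_{\min}}^{-1}G_h\cup\bigcup_{h=0}^{h_{\max}}(w_h(P)+hF)\big)$. It is again a Fano polygon, is independent of the choice of $\{G_h\}$, and up to $GL_2(\mathbb{Z})$ (in fact up to a shear fixing $w^\perp$) is independent of the sign of $v_E$. Seeds. Fix a lattice $L\cong\mathbb{Z}^n$ with a skew-symmetric form $\{\cdot,\cdot\}$. A seed is a pair $(B,C)$ where $B=\{e_1,\dots,e_n\}$ is a basis of $L$ and $C=\{x_1,\dots,x_n\}$ is a transcendence basis of $\mathbb{C}(L)$. With $b_{kl}=\{e_k,e_l\}$, the $j$th mutation of $(B,C)$ is the seed $(B',C')$ with $e'_j=-e_j$, $e'_k=e_k+\max(b_{kj},0)e_j$ for $k\neq j$, $x'_k=x_k$ for $k\neq j$, and $x_jx'_j=\prod_{k:\,b_{jk}>0}x_k^{b_{jk}}+\prod_{l:\,b_{jl}<0}x_l^{b_{lj}}$. Cluster algebra of $P$. Write $\wedge$ for the determinant on $M\cong\mathbb{Z}^2$ (with respect to a fixed basis). The quiver $Q_P$ has $n$ vertices, one for each primitive $T$-cone, and the number of arrows from the $i$th to the $j$th vertex is $\max\{w_i\wedge w_j,0\}$. The cluster algebra $\mathcal{A}_P$ is the one with $L=\mathbb{Z}^n$ having basis $e_1,\ldots,e_n$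 indexed by the vertices of $Q_P$, form $\{e_i,e_j\}=$ the signed number of arrows from the $i$th to the $j$th vertex (that is, $w_i\wedge w_j$), and initial seed $(B_P,C_P)$ with $B_P=\{e_1,\ldots,e_n\}$ and $C_P$ the standard transcendence basis of $\mathbb{C}(L)$. *)

theory Defs
  imports
    "HOL-Analysis.Analysis"
    "HOL-Library.Poly_Mapping"
    "HOL-Library.Multiset"
    "HOL-Computational_Algebra.Fraction_Field"
begin

section \<open>The lattices N and M\<close>

text \<open>
  N is the set of integer points of the plane and M, the dual lattice, is identified with
  pairs of integers via the dual basis. Lattice polygons are regarded as subsets of the real plane
  (a polygon with vertices in N is determined by its rational points).
\<close>

definition lattice_N :: "(real \<times> real) set" where
  "lattice_N = \<int> \<times> \<int>"

definition pairing :: "int \<times> int \<Rightarrow> real \<times> real \<Rightarrow> real" where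
  "pairing w v = of_int (fst w) * fst v + of_int (snd w) * snd v"

definition wedge :: "int \<times> int \<Rightarrow> int \<times> int \<Rightarrow> int" (infixl \<open>\<and>\<^sub>M\<close> 70) where
  "u \<and>\<^sub>M w = fst u * snd w - snd u * fst w"

definition primitive_M :: "int \<times> int \<Rightarrow> bool" where
  "primitive_M w \<longleftrightarrow> coprime (fst w) (snd w)"

definition primitive_N :: "real \<times> real \<Rightarrow> bool" where
  "primitive_N v \<longleftrightarrow> (\<exists>a b :: int. v = (of_int a, of_int b) \<and> coprime a b)"

definition GL2Z :: "(real \<times> real \<Rightarrow> real \<times> real) set" where
  "GL2Z = {g. linear g \<and> g ` lattice_N = lattice_N}"

section \<open>Fano polygons and their edges\<close>

definition fano_polygon :: "(real \<times> real) set \<Rightarrow> bool" where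
  "fano_polygon P \<longleftrightarrow> polytope P \<and> (\<forall>v. v extreme_point_of P \<longrightarrow> primitive_N v) \<and> 0 \<in> interior P"

definition edges :: "(real \<times> real) set \<Rightarrow> (real \<times> real) set set" where
  "edges P = {E. E edge_of P}"

definition inner_normal :: "(real \<times> real) set \<Rightarrow> (real \<times> real) set \<Rightarrow> int \<times> int" where
  "inner_normal P E = (THE w. primitive_M w \<and>
     (\<exists>c. (\<forall>v\<in>E. pairing w v = c) \<and> (\<forall>v\<in>P. c \<le> pairing w v)))"

definition height :: "(real \<times> real) set \<Rightarrow> (real \<times> real) set \<Rightarrow> nat" where
  "height P E = (THE r. \<forall>v\<in>E. pairing (inner_normal P E) v = - of_nat r)"

definition width :: "(real \<times> real) set \<Rightarrow> nat" where
  "width E = card (E \<inter> lattice_N) - 1"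

definition T_number :: "(real \<times> real) set \<Rightarrow> (real \<times> real) set \<Rightarrow> nat" where
  "T_number P E = width E div height P E"

definition residual_width :: "(real \<times> real) set \<Rightarrow> (real \<times> real) set \<Rightarrow> nat" where
  "residual_width P E = width E mod height P E"

section \<open>Primitive T-cones and singularity content\<close>

definition lattice_segment :: "(real \<times> real) set \<Rightarrow> bool" where
  "lattice_segment s \<longleftrightarrow> (\<exists>a\<in>lattice_N. \<exists>b\<in>lattice_N. a \<noteq> b \<and> s = closed_segment a b)"

text \<open>
  A subdivision of the edge E: \<open>A\<close> is the set of the segments whose width is the height of E,
  \<open>R\<close> is the set (empty or a singleton) of the residual segment.
\<close>

definition T_subdivision ::
  "(real \<times> real) set \<Rightarrow> (real \<times> real) set \<Rightarrow> (real \<times> real) set set \<Rightarrow> (real \<times> real) set set \<Rightarrow> bool"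
  where
  "T_subdivision P E A R \<longleftrightarrow>
     finite A \<and> card A = T_number P E \<and> (\<forall>s\<in>A. lattice_segment s \<and> width s = height P E) \<and>
     finite R \<and> card R = (if residual_width P E = 0 then 0 else 1) \<and>
     (\<forall>s\<in>R. lattice_segment s \<and> width s = residual_width P E) \<and>
     \<Union>(A \<union> R) = E \<and>
     pairwise (\<lambda>s t. rel_interior s \<inter> rel_interior t = {}) (A \<union> R)"

text \<open>\<open>\<T>\<close> is the set of primitive T-cones of \<open>P\<close> for some choice of a subdivision of every edge.\<close>

definition primitive_T_cones :: "(real \<times> real) set \<Rightarrow> (real \<times> real) set set \<Rightarrow> bool" where
  "primitive_T_cones P \<T> \<longleftrightarrow>
     (\<exists>A R. (\<forall>E\<in>edges P. T_subdivision P E (A E) (R E)) \<and>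
            \<T> = (\<Union>E\<in>edges P. (\<lambda>s. cone hull s) ` A E))"

definition determined_edge :: "(real \<times> real) set \<Rightarrow> (real \<times> real) set \<Rightarrow> (real \<times> real) set" where
  "determined_edge P C = (THE E. E \<in> edges P \<and> C \<subseteq> cone hull E)"

text \<open>
  The residue of an edge is a cyclic quotient singularity up to isomorphism, i.e. the cone over the
  residual segment up to \<open>GL2Z\<close>; it is encoded as the equivalence class of that cone.
\<close>

definition residue :: "(real \<times> real) set \<Rightarrow> (real \<times> real) set \<Rightarrow> (real \<times> real) set set" where
  "residue P E = {g ` (cone hull s) | g s. g \<in> GL2Z \<and> (\<exists>A R. T_subdivision P E A R \<and> s \<in> R)}"

text \<open>
  A cyclically ordered list is encoded as the set of all rotations of a list; the edges are
  ordered anticlockwise, by the argument of the inner normal.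
\<close>

definition basket :: "(real \<times> real) set \<Rightarrow> (real \<times> real) set set list set" where
  "basket P = {rotate m (map (residue P) Es) | m Es.
     distinct Es \<and> set Es = {E \<in> edges P. residual_width P E \<noteq> 0} \<and>
     sorted_wrt (\<lambda>E E'. Arg (case inner_normal P E of (a, b) \<Rightarrow> Complex (of_int a) (of_int b))
                      < Arg (case inner_normal P E' of (a, b) \<Rightarrow> Complex (of_int a) (of_int b))) Es}"

definition singularity_content ::
  "(real \<times> real) set \<Rightarrow> nat \<times> (real \<times> real) set set list set" where
  "singularity_content P = (\<Sum>E\<in>edges P. T_number P E, basket P)"

text \<open>
  \<open>X\<close> is the multiset of the inner normals to the edges determined by the primitive T-cones
  of \<open>P\<close>, for every choice of the subdivisions (and there is such a choice).
\<close>

definition T_cone_normals :: "(real \<times> real) set \<Rightarrow> (int \<times> int) multiset \<Rightarrow> bool" where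
  "T_cone_normals P X \<longleftrightarrow> (\<exists>\<T>. primitive_T_cones P \<T>) \<and>
     (\<forall>\<T>. primitive_T_cones P \<T> \<longrightarrow>
       finite \<T> \<and> {#inner_normal P (determined_edge P C). C \<in># mset_set \<T>#} = X)"

section \<open>Mutation of polygons\<close>

text \<open>For a lattice polygon the minimum and the maximum of \<open>w\<close> are integers, so the floors have no effect.\<close>

definition h_min :: "(real \<times> real) set \<Rightarrow> int \<times> int \<Rightarrow> int" where
  "h_min P w = \<lfloor>INF v\<in>P. pairing w v\<rfloor>"

definition h_max :: "(real \<times> real) set \<Rightarrow> int \<times> int \<Rightarrow> int" where
  "h_max P w = \<lfloor>SUP v\<in>P. pairing w v\<rfloor>"

definition slice :: "(real \<times> real) set \<Rightarrow> int \<times> int \<Rightarrow> int \<Rightarrow> (real \<times> real) set" where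
  "slice P w h = convex hull {v \<in> P \<inter> lattice_N. pairing w v = of_int h}"

definition lattice_polytope :: "(real \<times> real) set \<Rightarrow> bool" where
  "lattice_polytope G \<longleftrightarrow> (\<exists>V. finite V \<and> V \<subseteq> lattice_N \<and> G = convex hull V)"

text \<open>Addition of sets is Minkowski sum; \<open>dilate k v\<close> is \<open>k\<close> times the segment from 0 to \<open>v\<close>.\<close>

definition dilate :: "int \<Rightarrow> real \<times> real \<Rightarrow> (real \<times> real) set" where
  "dilate k v = (\<lambda>p. of_int k *\<^sub>R p) ` (convex hull {0, v})"

definition mutation_data ::
  "(real \<times> real) set \<Rightarrow> int \<times> int \<Rightarrow> real \<times> real \<Rightarrow> (int \<Rightarrow> (real \<times> real) set) \<Rightarrow> bool" where
  "mutation_data P w v G \<longleftrightarrow>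
     (\<exists>E\<in>edges P. w = inner_normal P E) \<and> primitive_N v \<and> pairing w v = 0 \<and>
     (\<forall>h\<in>{h_min P w..<0}. lattice_polytope (G h) \<and>
        {p. p extreme_point_of P \<and> pairing w p = of_int h} \<subseteq> G h + dilate \<bar>h\<bar> v \<and>
        G h + dilate \<bar>h\<bar> v \<subseteq> slice P w h)"

definition mut ::
  "(real \<times> real) set \<Rightarrow> int \<times> int \<Rightarrow> real \<times> real \<Rightarrow> (int \<Rightarrow> (real \<times> real) set) \<Rightarrow> (real \<times> real) set"
  where
  "mut P w v G = convex hull ((\<Union>h\<in>{h_min P w..-1}. G h) \<union>
                              (\<Union>h\<in>{0..h_max P w}. slice P w h + dilate h v))"

text \<open>
  \<open>P'\<close> is a mutation of \<open>P\<close> determined by \<open>w\<close>, for some choice of the sign of \<open>v\<close> and of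
  \<open>G\<close>; passing to \<open>GL2Z\<close>-equivalent polygons is left to the places of use.
\<close>

definition polygon_mutation ::
  "(real \<times> real) set \<Rightarrow> int \<times> int \<Rightarrow> (real \<times> real) set \<Rightarrow> bool" where
  "polygon_mutation P w P' \<longleftrightarrow> (\<exists>v G. mutation_data P w v G \<and> P' = mut P w v G)"

section \<open>Seeds and cluster mutation\<close>

text \<open>
  \<open>lattice_L n\<close> is the free abelian group of rank \<open>n\<close>, consisting of the integer combinations of the
  generators \<open>frag_of i\<close> with index in \<open>{1..n}\<close>. The group algebra of the lattice of all indices
  is \<open>(nat \<Rightarrow>\<^sub>0 int) \<Rightarrow>\<^sub>0 complex\<close>; the function field of \<open>lattice_L n\<close> is a
  subfield of its field of fractions.
\<close>

definition lattice_L :: "nat \<Rightarrow> (nat \<Rightarrow>\<^sub>0 int) set" where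
  "lattice_L n = {u. Poly_Mapping.keys u \<subseteq> {1..n}}"

type_synonym funfield = "((nat \<Rightarrow>\<^sub>0 int) \<Rightarrow>\<^sub>0 complex) fract"

definition function_field :: "nat \<Rightarrow> funfield set" where
  "function_field n = {Fract a b | a b. b \<noteq> 0 \<and>
     Poly_Mapping.keys a \<subseteq> lattice_L n \<and> Poly_Mapping.keys b \<subseteq> lattice_L n}"

text \<open>The elements of \<open>S\<close> serve as the variables of the polynomial \<open>p\<close>.\<close>

definition eval_poly :: "((funfield \<Rightarrow>\<^sub>0 nat) \<Rightarrow>\<^sub>0 complex) \<Rightarrow> funfield" where
  "eval_poly p = (\<Sum>m\<in>Poly_Mapping.keys p.
     Fract (Poly_Mapping.single 0 (Poly_Mapping.lookup p m)) 1 *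
     (\<Prod>s\<in>Poly_Mapping.keys m. s ^ Poly_Mapping.lookup m s))"

definition algebraically_independent :: "funfield set \<Rightarrow> bool" where
  "algebraically_independent S \<longleftrightarrow>
     (\<forall>p. (\<forall>m\<in>Poly_Mapping.keys p. Poly_Mapping.keys m \<subseteq> S) \<and> eval_poly p = 0 \<longrightarrow> p = 0)"

definition transcendence_basis :: "funfield set \<Rightarrow> funfield set \<Rightarrow> bool" where
  "transcendence_basis K S \<longleftrightarrow> S \<subseteq> K \<and> algebraically_independent S \<and>
     (\<forall>y\<in>K - S. \<not> algebraically_independent (insert y S))"

definition lattice_basis :: "nat \<Rightarrow> (nat \<Rightarrow> (nat \<Rightarrow>\<^sub>0 int)) \<Rightarrow> bool" where
  "lattice_basis n e \<longleftrightarrow> (\<forall>i\<in>{1..n}. e i \<in> lattice_L n) \<and>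
     (\<forall>u\<in>lattice_L n. \<exists>!c. (\<forall>i. i \<notin> {1..n} \<longrightarrow> c i = 0) \<and> u = (\<Sum>i=1..n. frag_cmul (c i) (e i)))"

type_synonym seed = "(nat \<Rightarrow> (nat \<Rightarrow>\<^sub>0 int)) \<times> (nat \<Rightarrow> funfield)"

definition is_seed :: "nat \<Rightarrow> seed \<Rightarrow> bool" where
  "is_seed n S \<longleftrightarrow> (case S of (e, x) \<Rightarrow>
     lattice_basis n e \<and> inj_on x {1..n} \<and> transcendence_basis (function_field n) (x ` {1..n}))"

definition initial_seed :: seed where
  "initial_seed = (frag_of, \<lambda>i. Fract (Poly_Mapping.single (frag_of i) 1) 1)"

definition seed_mutation ::
  "((nat \<Rightarrow>\<^sub>0 int) \<Rightarrow> (nat \<Rightarrow>\<^sub>0 int) \<Rightarrow> int) \<Rightarrow> nat \<Rightarrow> nat \<Rightarrow> seed \<Rightarrow> seed" where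
  "seed_mutation form n j S = (case S of (e, x) \<Rightarrow> let b = (\<lambda>k l. form (e k) (e l)) in
     (\<lambda>k. if k = j then - e j else e k + frag_cmul (max (b k j) 0) (e j),
      \<lambda>k. if k = j then ((\<Prod>i | i \<in> {1..n} \<and> b j i > 0. x i ^ nat (b j i)) +
                         (\<Prod>l | l \<in> {1..n} \<and> b j l < 0. x l ^ nat (b l j))) / x j
           else x k))"

subsection \<open>The initial seed is a seed\<close>

abbreviation x_std :: "nat \<Rightarrow> funfield" where
  "x_std i \<equiv> Fract (Poly_Mapping.single (frag_of i) 1) 1"

lemma Fract_sum: "(\<Sum>m\<in>A. Fract (f m) 1) = Fract (\<Sum>m\<in>A. f m) (1 :: 'a :: idom)"
  by (induction A rule: infinite_finite_induct) (simp_all add: Zero_fract_def)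

lemma Fract_prod: "(\<Prod>m\<in>A. Fract (f m) 1) = Fract (\<Prod>m\<in>A. f m) (1 :: 'a :: idom)"
  by (induction A rule: infinite_finite_induct) (simp_all add: One_fract_def)

lemma Fract_power: "Fract a 1 ^ k = Fract (a ^ k) (1 :: 'a :: idom)"
  by (induction k) (simp_all add: One_fract_def)

lemma single_prod:
  "(\<Prod>m\<in>A. Poly_Mapping.single (f m) (1 :: complex)) = Poly_Mapping.single (\<Sum>m\<in>A. f m :: nat \<Rightarrow>\<^sub>0 int) 1"
  by (induction A rule: infinite_finite_induct) (simp_all add: mult_single)

lemma x_std_power: "x_std i ^ k = Fract (Poly_Mapping.single (Poly_Mapping.single i (int k)) 1) 1"
  unfolding Fract_power
proof -
  have "Poly_Mapping.single (frag_of i) (1::complex) ^ k = Poly_Mapping.single (Poly_Mapping.single i (int k)) 1"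
    by (induction k) (simp_all add: mult_single single_add)
  thus "Fract (Poly_Mapping.single (frag_of i) (1::complex) ^ k) 1 = Fract (Poly_Mapping.single (Poly_Mapping.single i (int k)) 1) 1"
    by simp
qed

lemma inj_x_std: "inj x_std"
proof (rule injI)
  fix i j assume "x_std i = x_std j"
  hence "Poly_Mapping.single (frag_of i) (1::complex) = Poly_Mapping.single (frag_of j) 1"
    by (simp add: eq_fract)
  hence "Poly_Mapping.keys (Poly_Mapping.single (frag_of i) (1::complex)) = Poly_Mapping.keys (Poly_Mapping.single (frag_of j) (1::complex))"
    by simp
  hence "frag_of i = frag_of j" by simp
  hence "Poly_Mapping.keys (frag_of i) = Poly_Mapping.keys (frag_of j)" by simp
  thus "i = j" by simp
qed

lemma lattice_basis_initial: "lattice_basis n frag_of"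
proof -
  have lk: "Poly_Mapping.lookup (\<Sum>i=1..n. frag_cmul (c i) (frag_of i)) k = (if k \<in> {1..n} then c k else 0)" for c k
    by (auto simp add: lookup_sum if_distrib [of "\<lambda>t. _ * t"] sum.delta' cong: if_cong)
  have "\<exists>!c. (\<forall>i. i \<notin> {1..n} \<longrightarrow> c i = 0) \<and> u = (\<Sum>i=1..n. frag_cmul (c i) (frag_of i))"
    if "u \<in> lattice_L n" for u
  proof (rule ex1I [of _ "Poly_Mapping.lookup u"])
    have *: "\<forall>i. i \<notin> {1..n} \<longrightarrow> Poly_Mapping.lookup u i = 0"
      using that by (auto simp: lattice_L_def in_keys_iff subset_iff)
    show "(\<forall>i. i \<notin> {1..n} \<longrightarrow> Poly_Mapping.lookup u i = 0) \<and>
        u = (\<Sum>i=1..n. frag_cmul (Poly_Mapping.lookup u i) (frag_of i))"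
      using * by (auto intro!: poly_mapping_eqI simp only: lk split: if_splits)
  next
    fix c assume c: "(\<forall>i. i \<notin> {1..n} \<longrightarrow> c i = 0) \<and> u = (\<Sum>i=1..n. frag_cmul (c i) (frag_of i))"
    show "c = Poly_Mapping.lookup u"
    proof
      fix k
      have "Poly_Mapping.lookup u k = (if k \<in> {1..n} then c k else 0)"
        using c lk [of c k] by metis
      thus "c k = Poly_Mapping.lookup u k" using c by auto
    qed
  qed
  thus ?thesis by (auto simp: lattice_basis_def lattice_L_def)
qed

definition x_exponent :: "(funfield \<Rightarrow>\<^sub>0 nat) \<Rightarrow> (nat \<Rightarrow>\<^sub>0 int)" where
  "x_exponent m = (\<Sum>s\<in>Poly_Mapping.keys m. Poly_Mapping.single (inv x_std s) (int (Poly_Mapping.lookup m s)))"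

lemma x_monomial:
  assumes "Poly_Mapping.keys m \<subseteq> range x_std"
  shows "(\<Prod>s\<in>Poly_Mapping.keys m. s ^ Poly_Mapping.lookup m s) = Fract (Poly_Mapping.single (x_exponent m) 1) 1"
proof -
  have "(\<Prod>s\<in>Poly_Mapping.keys m. s ^ Poly_Mapping.lookup m s) =
    (\<Prod>s\<in>Poly_Mapping.keys m. Fract (Poly_Mapping.single (Poly_Mapping.single (inv x_std s) (int (Poly_Mapping.lookup m s))) 1) 1)"
  proof (rule prod.cong)
    fix s assume "s \<in> Poly_Mapping.keys m"
    then obtain i where s: "s = x_std i" using assms by auto
    have "inv x_std s = i" unfolding s using inj_x_std by (rule inv_f_f)
    thus "s ^ Poly_Mapping.lookup m s = Fract (Poly_Mapping.single (Poly_Mapping.single (inv x_std s) (int (Poly_Mapping.lookup m s))) 1) 1"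
      using s x_std_power by simp
  qed simp
  thus ?thesis by (simp add: Fract_prod single_prod x_exponent_def)
qed

lemma lookup_x_exponent:
  assumes "Poly_Mapping.keys m \<subseteq> range x_std"
  shows "Poly_Mapping.lookup (x_exponent m) i = int (Poly_Mapping.lookup m (x_std i))"
proof -
  have "Poly_Mapping.lookup (x_exponent m) i =
     (\<Sum>s\<in>Poly_Mapping.keys m. if s = x_std i then int (Poly_Mapping.lookup m s) else 0)"
    unfolding x_exponent_def lookup_sum
  proof (rule sum.cong)
    fix s assume "s \<in> Poly_Mapping.keys m"
    then obtain k where s: "s = x_std k" using assms by auto
    have "inv x_std s = k" unfolding s using inj_x_std by (rule inv_f_f)
    moreover have "s = x_std i \<longleftrightarrow> k = i" unfolding s using inj_x_std by (auto dest: injD)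
    ultimately show "Poly_Mapping.lookup (Poly_Mapping.single (inv x_std s) (int (Poly_Mapping.lookup m s))) i =
        (if s = x_std i then int (Poly_Mapping.lookup m s) else 0)"
      by (simp add: lookup_single when_def)
  qed simp
  also have "\<dots> = int (Poly_Mapping.lookup m (x_std i))"
    by (simp add: sum.delta in_keys_iff)
  finally show ?thesis .
qed

lemma x_exponent_inj:
  assumes "Poly_Mapping.keys m \<subseteq> range x_std" "Poly_Mapping.keys m' \<subseteq> range x_std"
    "x_exponent m = x_exponent m'"
  shows "m = m'"
proof (rule poly_mapping_eqI)
  fix s
  show "Poly_Mapping.lookup m s = Poly_Mapping.lookup m' s"
  proof (cases "s \<in> range x_std")
    case True
    then obtain i where "s = x_std i" by auto
    thus ?thesis using lookup_x_exponent [OF assms(1), of i] lookup_x_exponent [OF assms(2), of i] assms(3)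
      by simp
  next
    case False
    hence "s \<notin> Poly_Mapping.keys m" "s \<notin> Poly_Mapping.keys m'" using assms by auto
    thus ?thesis by (simp add: in_keys_iff)
  qed
qed

lemma algebraically_independent_x: "algebraically_independent (x_std ` {1..n})"
  unfolding algebraically_independent_def
proof (intro allI impI, elim conjE)
  fix p :: "(funfield \<Rightarrow>\<^sub>0 nat) \<Rightarrow>\<^sub>0 complex"
  assume keys: "\<forall>m\<in>Poly_Mapping.keys p. Poly_Mapping.keys m \<subseteq> x_std ` {1..n}" and ev: "eval_poly p = 0"
  have rng: "Poly_Mapping.keys m \<subseteq> range x_std" if "m \<in> Poly_Mapping.keys p" for m
    using keys that by blast
  have "eval_poly p = (\<Sum>m\<in>Poly_Mapping.keys p. Fract (Poly_Mapping.single (x_exponent m) (Poly_Mapping.lookup p m)) 1)"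
    unfolding eval_poly_def by (rule sum.cong) (simp_all add: x_monomial rng mult_single)
  hence z: "(\<Sum>m\<in>Poly_Mapping.keys p. Poly_Mapping.single (x_exponent m) (Poly_Mapping.lookup p m)) = 0"
    using ev by (simp add: Fract_sum Zero_fract_def eq_fract)
  have "Poly_Mapping.lookup p m = 0" if m: "m \<in> Poly_Mapping.keys p" for m
  proof -
    have "0 = Poly_Mapping.lookup (\<Sum>m\<in>Poly_Mapping.keys p. Poly_Mapping.single (x_exponent m) (Poly_Mapping.lookup p m)) (x_exponent m)"
      using z by simp
    also have "\<dots> = (\<Sum>k\<in>Poly_Mapping.keys p. if k = m then Poly_Mapping.lookup p k else 0)"
      unfolding lookup_sum
      by (rule sum.cong) (use x_exponent_inj rng m in \<open>auto simp: lookup_single when_def\<close>)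
    also have "\<dots> = Poly_Mapping.lookup p m" using m by (simp add: sum.delta)
    finally show ?thesis by simp
  qed
  thus "p = 0" by (metis in_keys_iff poly_mapping_eqI lookup_zero)
qed

definition monomial_value :: "(funfield \<Rightarrow>\<^sub>0 nat) \<Rightarrow> funfield" where
  "monomial_value m = (\<Prod>s\<in>Poly_Mapping.keys m. s ^ Poly_Mapping.lookup m s)"

lemma monomial_value_superset:
  assumes "finite A" "Poly_Mapping.keys m \<subseteq> A"
  shows "monomial_value m = (\<Prod>s\<in>A. s ^ Poly_Mapping.lookup m s)"
  unfolding monomial_value_def using assms
  by (intro prod.mono_neutral_left) (auto simp: in_keys_iff)

lemma monomial_value_add: "monomial_value (m + m') = monomial_value m * monomial_value m'"
proof -
  let ?A = "Poly_Mapping.keys m \<union> Poly_Mapping.keys m'"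
  have "Poly_Mapping.keys (m + m') \<subseteq> ?A" by (rule Poly_Mapping.keys_add)
  thus ?thesis
    by (simp add: monomial_value_superset [of ?A] lookup_add power_add prod.distrib)
qed

lemma monomial_value_single: "monomial_value (Poly_Mapping.single s k) = s ^ k"
  using monomial_value_superset [of "{s}" "Poly_Mapping.single s k"] by (simp add: lookup_single)

lemma eval_poly_superset:
  assumes "finite A" "Poly_Mapping.keys p \<subseteq> A"
  shows "eval_poly p = (\<Sum>m\<in>A. Fract (Poly_Mapping.single 0 (Poly_Mapping.lookup p m)) 1 * monomial_value m)"
  unfolding eval_poly_def monomial_value_def using assms
  by (intro sum.mono_neutral_left) (auto simp: in_keys_iff Zero_fract_def [symmetric])

lemma eval_poly_add: "eval_poly (p + q) = eval_poly p + eval_poly q"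
proof -
  let ?A = "Poly_Mapping.keys p \<union> Poly_Mapping.keys q"
  have "Poly_Mapping.keys (p + q) \<subseteq> ?A" by (rule Poly_Mapping.keys_add)
  moreover have "Fract (Poly_Mapping.single 0 (Poly_Mapping.lookup p m + Poly_Mapping.lookup q m)) 1 =
     Fract (Poly_Mapping.single 0 (Poly_Mapping.lookup p m)) 1 + Fract (Poly_Mapping.single (0 :: nat \<Rightarrow>\<^sub>0 int) (Poly_Mapping.lookup q m)) 1" for m
    by (simp add: single_add)
  ultimately show ?thesis
    by (simp add: eval_poly_superset [of ?A] lookup_add ring_distribs sum.distrib del: add_fract)
qed

lemma eval_poly_sum: "eval_poly (\<Sum>k\<in>A. f k) = (\<Sum>k\<in>A. eval_poly (f k))"
  by (induction A rule: infinite_finite_induct) (simp_all add: eval_poly_add, simp_all add: eval_poly_def)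

lemma eval_poly_single:
  "eval_poly (Poly_Mapping.single m c) = Fract (Poly_Mapping.single 0 c) 1 * monomial_value m"
  using eval_poly_superset [of "{m}" "Poly_Mapping.single m c"] by (simp add: lookup_single)

lemma poly_mapping_expand:
  "(\<Sum>k\<in>Poly_Mapping.keys a. Poly_Mapping.single k (Poly_Mapping.lookup a k)) = a"
  by (rule poly_mapping_eqI)
    (auto simp: lookup_sum lookup_single when_def sum.delta' in_keys_iff)

lemma transcendence_basis_maximal:
  assumes y: "y \<in> function_field n" "y \<notin> x_std ` {1..n}"
  shows "\<not> algebraically_independent (insert y (x_std ` {1..n}))"
proof -
  obtain a b where ab: "y = Fract a b" "b \<noteq> 0"
    "Poly_Mapping.keys a \<subseteq> lattice_L n" "Poly_Mapping.keys b \<subseteq> lattice_L n"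
    using y by (auto simp: function_field_def)
  let ?K = "Poly_Mapping.keys a \<union> Poly_Mapping.keys b"
  define N where "N = (\<Sum>k\<in>?K. \<Sum>i=1..n. \<bar>Poly_Mapping.lookup k i\<bar>)"
  have N: "0 \<le> Poly_Mapping.lookup k i + N" if "k \<in> ?K" "i \<in> {1..n}" for k i
  proof -
    have "\<bar>Poly_Mapping.lookup k i\<bar> \<le> (\<Sum>i=1..n. \<bar>Poly_Mapping.lookup k i\<bar>)"
      using that by (intro member_le_sum) auto
    also have "\<dots> \<le> N" unfolding N_def
      using that(1) by (intro member_le_sum [of k ?K "\<lambda>k. \<Sum>i=1..n. \<bar>Poly_Mapping.lookup k i\<bar>"]) (auto intro: sum_nonneg)
    finally show ?thesis by linarith
  qed
  define u :: "nat \<Rightarrow>\<^sub>0 int" where "u = (\<Sum>i=1..n. Poly_Mapping.single i N)"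
  define \<psi> where "\<psi> k = (\<Sum>i=1..n. Poly_Mapping.single (x_std i) (nat (Poly_Mapping.lookup k i + N)))" for k
  have lu: "Poly_Mapping.lookup u i = (if i \<in> {1..n} then N else 0)" for i
    by (auto simp: u_def lookup_sum lookup_single when_def sum.delta')
  have kpsi: "Poly_Mapping.keys (\<psi> k) \<subseteq> x_std ` {1..n}" for k
  proof
    fix s assume "s \<in> Poly_Mapping.keys (\<psi> k)"
    hence "(\<Sum>i=1..n. Poly_Mapping.lookup (Poly_Mapping.single (x_std i) (nat (Poly_Mapping.lookup k i + N))) s) \<noteq> 0"
      by (simp add: in_keys_iff \<psi>_def lookup_sum)
    then obtain i where "i \<in> {1..n}" "Poly_Mapping.lookup (Poly_Mapping.single (x_std i) (nat (Poly_Mapping.lookup k i + N))) s \<noteq> 0"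
      by (meson sum.neutral)
    thus "s \<in> x_std ` {1..n}" by (auto simp: lookup_single when_def split: if_splits)
  qed
  have lpsi: "Poly_Mapping.lookup (\<psi> k) (x_std i) = nat (Poly_Mapping.lookup k i + N)" if "i \<in> {1..n}" for k i
  proof -
    have "Poly_Mapping.lookup (\<psi> k) (x_std i) = (\<Sum>j=1..n. if j = i then nat (Poly_Mapping.lookup k j + N) else 0)"
      unfolding \<psi>_def lookup_sum
    proof (rule sum.cong)
      fix j
      have "x_std j = x_std i \<longleftrightarrow> j = i" using inj_x_std by (auto dest: injD)
      thus "Poly_Mapping.lookup (Poly_Mapping.single (x_std j) (nat (Poly_Mapping.lookup k j + N))) (x_std i) =
         (if j = i then nat (Poly_Mapping.lookup k j + N) else 0)"
        by (simp only: lookup_single when_def)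
    qed simp
    thus ?thesis using that by (simp add: sum.delta)
  qed
  have lL: "Poly_Mapping.lookup k i = 0" if "k \<in> ?K" "i \<notin> {1..n}" for k i
    using that ab(3,4) by (auto simp: lattice_L_def in_keys_iff subset_iff)
  have expsi: "x_exponent (\<psi> k) = k + u" if k: "k \<in> ?K" for k
  proof (rule poly_mapping_eqI)
    fix i
    have r: "Poly_Mapping.keys (\<psi> k) \<subseteq> range x_std" using kpsi by blast
    show "Poly_Mapping.lookup (x_exponent (\<psi> k)) i = Poly_Mapping.lookup (k + u) i"
    proof (cases "i \<in> {1..n}")
      case True
      thus ?thesis using N [OF k True] unfolding lookup_x_exponent [OF r] lookup_add lu lpsi [OF True] by simp
    next
      case False
      hence "x_std i \<notin> x_std ` {1..n}" using inj_x_std by (auto dest: injD)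
      hence "Poly_Mapping.lookup (\<psi> k) (x_std i) = 0" using kpsi by (meson in_keys_iff subsetD)
      thus ?thesis using lL [OF k False] unfolding lookup_x_exponent [OF r] lookup_add lu if_not_P [OF False] by simp
    qed
  qed
  have mon: "monomial_value (\<psi> k) = Fract (Poly_Mapping.single (k + u) 1) 1" if "k \<in> ?K" for k
  proof -
    have r: "Poly_Mapping.keys (\<psi> k) \<subseteq> range x_std" using kpsi by blast
    show ?thesis unfolding monomial_value_def x_monomial [OF r] expsi [OF that] ..
  qed
  have inj: "k = k'" if "k \<in> ?K" "k' \<in> ?K" "\<psi> k = \<psi> k'" for k k'
    using expsi [OF that(1)] expsi [OF that(2)] that(3) by (metis add_right_cancel)
  define p1 where "p1 = (\<Sum>k\<in>Poly_Mapping.keys b. Poly_Mapping.single (\<psi> k + Poly_Mapping.single y 1) (Poly_Mapping.lookup b k))"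
  define p2 where "p2 = (\<Sum>k\<in>Poly_Mapping.keys a. Poly_Mapping.single (\<psi> k) (- Poly_Mapping.lookup a k))"
  have e1: "eval_poly p1 = Fract (Poly_Mapping.single u 1 * b) 1 * y"
  proof -
    have "eval_poly p1 = (\<Sum>k\<in>Poly_Mapping.keys b. Fract (Poly_Mapping.single u 1 * Poly_Mapping.single k (Poly_Mapping.lookup b k)) 1 * y)"
      unfolding p1_def eval_poly_sum
    proof (rule sum.cong)
      fix k assume "k \<in> Poly_Mapping.keys b"
      hence "monomial_value (\<psi> k) = Fract (Poly_Mapping.single (k + u) 1) 1" by (intro mon) simp
      thus "eval_poly (Poly_Mapping.single (\<psi> k + Poly_Mapping.single y 1) (Poly_Mapping.lookup b k)) =
        Fract (Poly_Mapping.single u 1 * Poly_Mapping.single k (Poly_Mapping.lookup b k)) 1 * y"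
        unfolding eval_poly_single monomial_value_add monomial_value_single
        by (simp add: mult_single add.commute [of k u])
    qed simp
    also have "\<dots> = Fract (Poly_Mapping.single u 1 * b) 1 * y"
      by (simp add: sum_distrib_right [symmetric] Fract_sum sum_distrib_left [symmetric] poly_mapping_expand)
    finally show ?thesis .
  qed
  have e2: "eval_poly p2 = Fract (- (Poly_Mapping.single u 1 * a)) 1"
  proof -
    have "eval_poly p2 = (\<Sum>k\<in>Poly_Mapping.keys a. Fract (- (Poly_Mapping.single u 1 * Poly_Mapping.single k (Poly_Mapping.lookup a k))) 1)"
      unfolding p2_def eval_poly_sum
    proof (rule sum.cong)
      fix k assume "k \<in> Poly_Mapping.keys a"
      hence "monomial_value (\<psi> k) = Fract (Poly_Mapping.single (k + u) 1) 1" by (intro mon) simp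
      thus "eval_poly (Poly_Mapping.single (\<psi> k) (- Poly_Mapping.lookup a k)) =
        Fract (- (Poly_Mapping.single u 1 * Poly_Mapping.single k (Poly_Mapping.lookup a k))) 1"
        unfolding eval_poly_single
        by (simp add: mult_single single_uminus add.commute [of k u] del: minus_fract)
    qed simp
    also have "\<dots> = Fract (- (Poly_Mapping.single u 1 * a)) 1"
      by (simp add: Fract_sum sum_negf sum_distrib_left [symmetric] poly_mapping_expand del: minus_fract)
    finally show ?thesis .
  qed
  have ev: "eval_poly (p1 + p2) = 0"
    unfolding eval_poly_add e1 e2 ab(1) using ab(2)
    by (simp add: Zero_fract_def eq_fract algebra_simps)
  obtain k0 where k0: "k0 \<in> Poly_Mapping.keys b" using ab(2) keys_eq_empty [of b] by blast
  have ypsi: "Poly_Mapping.lookup (\<psi> k) y = 0" for k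
    proof -
    have "y \<notin> Poly_Mapping.keys (\<psi> k)" using kpsi [of k] y(2) by blast
    thus ?thesis by (simp only: in_keys_iff not_not)
  qed
  have l2: "Poly_Mapping.lookup p2 (\<psi> k0 + Poly_Mapping.single y 1) = 0"
  proof -
    have "\<psi> k \<noteq> \<psi> k0 + Poly_Mapping.single y 1" for k
    proof
      assume "\<psi> k = \<psi> k0 + Poly_Mapping.single y 1"
      hence "Poly_Mapping.lookup (\<psi> k) y = Poly_Mapping.lookup (\<psi> k0) y + 1"
        by (simp only: lookup_add lookup_single_eq)
      thus False unfolding ypsi by simp
    qed
    hence "Poly_Mapping.lookup (Poly_Mapping.single (\<psi> k) c) (\<psi> k0 + Poly_Mapping.single y 1) = 0" for k c
      unfolding lookup_single when_def by (rule if_not_P)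
    thus ?thesis unfolding p2_def lookup_sum by (intro sum.neutral ballI)
  qed
  have l1: "Poly_Mapping.lookup p1 (\<psi> k0 + Poly_Mapping.single y 1) = Poly_Mapping.lookup b k0"
  proof -
    have "Poly_Mapping.lookup p1 (\<psi> k0 + Poly_Mapping.single y 1) =
      (\<Sum>k\<in>Poly_Mapping.keys b. if k = k0 then Poly_Mapping.lookup b k else 0)"
      unfolding p1_def lookup_sum
    proof (rule sum.cong)
      fix k assume "k \<in> Poly_Mapping.keys b"
      hence "\<psi> k + Poly_Mapping.single y 1 = \<psi> k0 + Poly_Mapping.single y 1 \<longleftrightarrow> k = k0"
        using inj [of k k0] k0 by auto
      thus "Poly_Mapping.lookup (Poly_Mapping.single (\<psi> k + Poly_Mapping.single y 1) (Poly_Mapping.lookup b k))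
          (\<psi> k0 + Poly_Mapping.single y 1) = (if k = k0 then Poly_Mapping.lookup b k else 0)"
        by (simp only: lookup_single when_def)
    qed simp
    thus ?thesis using k0 by (simp add: sum.delta)
  qed
  have "Poly_Mapping.lookup (p1 + p2) (\<psi> k0 + Poly_Mapping.single y 1) \<noteq> 0"
    using k0 unfolding lookup_add l1 l2 by (simp add: in_keys_iff)
  hence nz: "p1 + p2 \<noteq> 0" by (metis lookup_zero)
  have "Poly_Mapping.keys m \<subseteq> insert y (x_std ` {1..n})" if m: "m \<in> Poly_Mapping.keys (p1 + p2)" for m
  proof -
    have sing: "c = d" if "c \<in> Poly_Mapping.keys (Poly_Mapping.single d z)" for c d :: "funfield \<Rightarrow>\<^sub>0 nat" and z :: complex
      using that unfolding keys_single by (cases "z = 0") simp_all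
    have ky: "Poly_Mapping.keys (\<psi> k + Poly_Mapping.single y 1) \<subseteq> insert y (x_std ` {1..n})" for k
    proof -
      have "Poly_Mapping.keys (Poly_Mapping.single y (1 :: nat)) = {y}" by (rule trans [OF keys_single]) simp
      thus ?thesis
        using Poly_Mapping.keys_add [of "\<psi> k" "Poly_Mapping.single y 1"] kpsi [of k] by blast
    qed
    have "m \<in> Poly_Mapping.keys p1 \<union> Poly_Mapping.keys p2"
      by (rule subsetD [OF Poly_Mapping.keys_add m])
    thus ?thesis
    proof
      assume "m \<in> Poly_Mapping.keys p1"
      from subsetD [OF Poly_Mapping.keys_sum this [unfolded p1_def]]
      obtain k where "m = \<psi> k + Poly_Mapping.single y 1" by (elim UN_E) (rule that, erule sing)
      thus ?thesis using ky [of k] by simp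
    next
      assume "m \<in> Poly_Mapping.keys p2"
      from subsetD [OF Poly_Mapping.keys_sum this [unfolded p2_def]]
      obtain k where "m = \<psi> k" by (elim UN_E) (rule that, erule sing)
      thus ?thesis using kpsi [of k] by blast
    qed
  qed
  thus ?thesis using ev nz unfolding algebraically_independent_def by blast
qed

lemma is_seed_initial_seed: "is_seed n initial_seed"
proof -
  have "x_std i \<in> function_field n" if "i \<in> {1..n}" for i
    unfolding function_field_def
    by (rule CollectI, rule exI [of _ "Poly_Mapping.single (frag_of i) 1"], rule exI [of _ 1])
      (use that in \<open>auto simp: lattice_L_def\<close>)
  hence "transcendence_basis (function_field n) (x_std ` {1..n})"
    using algebraically_independent_x transcendence_basis_maximal
    unfolding transcendence_basis_def by blast
  moreover have "inj_on x_std {1..n}" by (rule inj_on_subset [OF inj_x_std]) simp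
  ultimately show ?thesis
    using lattice_basis_initial unfolding is_seed_def initial_seed_def by simp
qed

section \<open>The cluster algebra of a polygon\<close>

definition arrows :: "(nat \<Rightarrow> int \<times> int) \<Rightarrow> nat \<Rightarrow> nat \<Rightarrow> nat" where
  "arrows w i j = nat (max (w i \<and>\<^sub>M w j) 0)"

definition quiver_form ::
  "(nat \<Rightarrow> int \<times> int) \<Rightarrow> (nat \<Rightarrow>\<^sub>0 int) \<Rightarrow> (nat \<Rightarrow>\<^sub>0 int) \<Rightarrow> int" where
  "quiver_form w u v = (\<Sum>i\<in>Poly_Mapping.keys u. \<Sum>j\<in>Poly_Mapping.keys v.
     Poly_Mapping.lookup u i * Poly_Mapping.lookup v j * (int (arrows w i j) - int (arrows w j i)))"

end

theory Submission
  imports Defs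
begin

text \<open>
  Write \<open>w = w\<^sub>j\<close> and let \<open>v\<close> be the primitive vector with \<open>u(v) = - (u \<and> w)\<close> for all \<open>u\<close>; call the
  direction of \<open>v\<close> horizontal, so that \<open>w\<close> measures the level of a point. The mutation of \<open>P\<close> in the
  direction \<open>v\<close> has a description without convex hulls and without the auxiliary polytopes: on every
  horizontal line the left end point of \<open>P\<close> stays where it is and the right end point is moved by
  the shear \<open>p \<mapsto> p + w(p) v\<close> (\<open>mut_eq_half_shear\<close>). This half shear is the convex hull of the left
  vertices of \<open>P\<close> and the sheared right vertices, so it is again a Fano polygon. The two end points
  do not change places because the bottom edge is at least as wide as it is high, and by convexity the line at
  level \<open>-t\<close> then meets \<open>P\<close> in a segment of length at least \<open>t\<close>. The same inequality says that the
  bottom edge has a primitive T-cone, and the auxiliary polytopes of a mutation exist exactly when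
  it holds; this is why the mutations of \<open>P\<close> are those determined by the \<open>w\<^sub>j\<close>.

  For T-cones it is enough to know, for every primitive functional \<open>u\<close>, the width and the height of the
  face on which \<open>u\<close> is minimal: \<open>T_count P u\<close>, their integer quotient, is the multiplicity of \<open>u\<close> among the
  normals of the primitive T-cones (\<open>primitive_T_cones_count\<close>). Allowing faces that are vertices
  removes any need to match the edges of \<open>P\<close> with those of its mutation. If \<open>u(v) > 0\<close>, the minimum
  is taken on the left side, where nothing changes. If \<open>u(v) < 0\<close>, it is taken on the right side,
  which is sheared, and \<open>u\<close> has to be replaced by \<open>u - u(v) w\<close>. Both cases together are the map
  \<open>u \<mapsto> u + max(u \<and> w, 0) w\<close>, which is exactly what the seed mutation does to \<open>\<pi>(e\<^sub>k) = w\<^sub>k\<close> for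
  \<open>k \<noteq> j\<close>. The two
  horizontal faces remain (\<open>T_count_mutated\<close>): the bottom edge gets shorter by its height and loses
  one T-cone, the top face gets longer by its height and gains one. So one copy of \<open>w\<close> becomes
  \<open>- w\<close>, in accordance with \<open>e\<^sub>j' = - e\<^sub>j\<close>.

  The direction \<open>- v\<close> gives the mirror image of the same construction, and the results differ by the
  shear, an element of \<open>GL2Z\<close> (\<open>half_shear_uminus\<close>); the statements on the right side are
  also deduced from those on the left side in this way.
\<close>

section \<open>The pairing and primitive vectors\<close>

lemma pairing_add: "pairing u (p + q) = pairing u p + pairing u q"
  by (simp add: pairing_def algebra_simps)

lemma pairing_diff: "pairing u (p - q) = pairing u p - pairing u q"
  by (simp add: pairing_def algebra_simps)

lemma pairing_scaleR: "pairing u (t *\<^sub>R p) = t * pairing u p"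
  by (simp add: pairing_def algebra_simps)

lemma pairing_zero: "pairing u 0 = 0"
  by (simp add: pairing_def)

lemma pairing_uminus: "pairing (- u) p = - pairing u p"
  by (simp add: pairing_def)

lemmas pairing_linear = pairing_add pairing_diff pairing_scaleR pairing_zero

lemma pairing_inner: "pairing u p = (of_int (fst u), of_int (snd u)) \<bullet> p"
  by (cases p) (simp add: pairing_def)

lemma continuous_on_pairing [continuous_intros]: "continuous_on S (pairing u)"
  unfolding pairing_def by (intro continuous_intros)

lemma pairing_lattice:
  assumes "p \<in> lattice_N"
  shows "\<exists>m :: int. pairing u p = of_int m"
proof -
  obtain a b :: int where "p = (of_int a, of_int b)"
    using assms by (auto simp: lattice_N_def elim!: Ints_cases)
  hence "pairing u p = of_int (fst u * a + snd u * b)" by (simp add: pairing_def)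
  thus ?thesis by blast
qed

lemma lattice_N_add: "p \<in> lattice_N \<Longrightarrow> q \<in> lattice_N \<Longrightarrow> p + q \<in> lattice_N"
  by (auto simp: lattice_N_def)

lemma lattice_N_diff: "p \<in> lattice_N \<Longrightarrow> q \<in> lattice_N \<Longrightarrow> p - q \<in> lattice_N"
  by (auto simp: lattice_N_def)

lemma lattice_N_scaleR: "p \<in> lattice_N \<Longrightarrow> m \<in> \<int> \<Longrightarrow> m *\<^sub>R p \<in> lattice_N"
  by (auto simp: lattice_N_def)

lemma primitive_N_lattice: "primitive_N v \<Longrightarrow> v \<in> lattice_N"
  by (auto simp: primitive_N_def lattice_N_def)

lemma primitive_M_nonzero: "primitive_M u \<Longrightarrow> u \<noteq> 0"
  by (auto simp: primitive_M_def)

lemma primitive_M_uminus [simp]: "primitive_M (- u) \<longleftrightarrow> primitive_M u"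
  by (simp add: primitive_M_def)

definition perp :: "int \<times> int \<Rightarrow> real \<times> real" where
  "perp u = (- of_int (snd u), of_int (fst u))"

lemma perp_uminus [simp]: "perp (- u) = - perp u"
  by (simp add: perp_def)

lemma pairing_perp: "pairing u (perp w) = - of_int (u \<and>\<^sub>M w)"
  by (simp add: pairing_def perp_def wedge_def)

lemma pairing_perp_self [simp]: "pairing u (perp u) = 0"
  by (simp add: pairing_def perp_def)

lemma primitive_N_perp: "primitive_M u \<Longrightarrow> primitive_N (perp u)"
  unfolding primitive_N_def primitive_M_def perp_def
  by (intro exI [of _ "- snd u"] exI [of _ "fst u"]) (simp add: coprime_commute)

lemma perp_nonzero: "primitive_M u \<Longrightarrow> perp u \<noteq> 0"
  by (auto simp: primitive_M_def perp_def zero_prod_def)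

lemma pairing_eq_0_imp_perp:
  assumes "primitive_M u" "pairing u p = 0"
  shows "\<exists>t. p = t *\<^sub>R perp u"
proof -
  obtain x y where p: "p = (x, y)" by (cases p)
  define a b :: real where "a = of_int (fst u)" and "b = of_int (snd u)"
  have nz: "a ^ 2 + b ^ 2 \<noteq> 0"
    using primitive_M_nonzero [OF assms(1)] by (cases u) (simp add: a_def b_def sum_power2_eq_zero_iff zero_prod_def)
  have eq: "a * x + b * y = 0" using assms(2) by (simp add: p pairing_def a_def b_def)
  define t where "t = (a * y - b * x) / (a ^ 2 + b ^ 2)"
  have "t * (a ^ 2 + b ^ 2) = a * y - b * x" using nz by (simp add: t_def)
  have bx: "- (b * (a * y - b * x)) = x * (a ^ 2 + b ^ 2)" using eq by algebra
  have ay: "a * (a * y - b * x) = y * (a ^ 2 + b ^ 2)" using eq by algebra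
  have "x = t * - b" unfolding t_def using nz bx by (simp add: field_simps)
  moreover have "y = t * a" unfolding t_def using nz ay by (simp add: field_simps)
  ultimately have "p = t *\<^sub>R perp u" by (simp add: p perp_def a_def b_def)
  thus ?thesis ..
qed

text \<open>A Bezout relation for the coordinates of \<open>u\<close> recovers the coefficient from the point by
  an integral linear form.\<close>

lemma scaleR_primitive_lattice:
  assumes "primitive_N v" "t *\<^sub>R v \<in> lattice_N"
  shows "t \<in> \<int>"
proof -
  obtain a b :: int where v: "v = (of_int a, of_int b)" and "coprime a b"
    using assms(1) by (auto simp: primitive_N_def)
  then obtain r s where "r * a + s * b = 1"
    using bezout_int [of a b] by (auto simp: coprime_iff_gcd_eq_1)
  hence "(of_int r * of_int a + of_int s * of_int b :: real) = 1"
    by (metis of_int_1 of_int_add of_int_mult)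
  hence "t = of_int r * (t * of_int a) + of_int s * (t * of_int b)" by algebra
  moreover have "t * of_int a \<in> \<int>" "t * of_int b \<in> \<int>"
    using assms(2) by (auto simp: v lattice_N_def)
  ultimately show ?thesis by (metis Ints_add Ints_mult Ints_of_int)
qed

lemma pairing_eq_0_imp_perp_lattice:
  assumes "primitive_M u" "pairing u p = 0" "p \<in> lattice_N"
  shows "\<exists>m :: int. p = of_int m *\<^sub>R perp u"
proof -
  obtain t where t: "p = t *\<^sub>R perp u" using pairing_eq_0_imp_perp assms by blast
  hence "t \<in> \<int>" using scaleR_primitive_lattice [OF primitive_N_perp] assms by metis
  thus ?thesis using t by (auto elim: Ints_cases)
qed

lemma primitive_N_eq_perp:
  assumes "primitive_M u" "primitive_N v" "pairing u v = 0"
  shows "v = perp u \<or> v = - perp u"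
proof -
  obtain m :: int where m: "v = of_int m *\<^sub>R perp u"
    using pairing_eq_0_imp_perp_lattice [OF assms(1,3)] primitive_N_lattice [OF assms(2)] by blast
  obtain a b :: int where v: "v = (of_int a, of_int b)" and "coprime a b"
    using assms(2) by (auto simp: primitive_N_def)
  have "real_of_int a = of_int (m * - snd u)" "real_of_int b = of_int (m * fst u)"
    using m by (simp_all add: v perp_def)
  hence "m dvd a" "m dvd b" unfolding of_int_eq_iff by simp_all
  hence "is_unit m" using \<open>coprime a b\<close> by (meson coprime_common_divisor)
  hence "m = 1 \<or> m = - 1" by auto
  thus ?thesis using m by auto
qed

lemma perp_inject: "perp u = perp w \<longleftrightarrow> u = w"
  by (auto simp: perp_def prod_eq_iff)

text \<open>This makes inner normals unique up to sign as soon as two points of an edge are known.\<close>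

lemma primitive_M_same_kernel:
  assumes "primitive_M u" "primitive_M w" "d \<noteq> 0" "pairing u d = 0" "pairing w d = 0"
  shows "w = u \<or> w = - u"
proof -
  obtain t where t: "d = t *\<^sub>R perp w" using pairing_eq_0_imp_perp assms by blast
  with assms have "pairing u (perp w) = 0" by (auto simp: pairing_scaleR)
  from primitive_N_eq_perp [OF assms(1) primitive_N_perp [OF assms(2)] this]
  show ?thesis by (metis perp_inject perp_uminus)
qed

lemma wedge_eq_0_primitive:
  assumes "primitive_M u" "primitive_M w" "u \<and>\<^sub>M w = 0"
  shows "u = w \<or> u = - w"
  using primitive_M_same_kernel [OF assms(2,1) perp_nonzero [OF assms(2)]] assms(3)
  by (simp add: pairing_perp)

lemma exists_primitive_annihilator:
  assumes "d \<in> lattice_N" "d \<noteq> 0"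
  shows "\<exists>u. primitive_M u \<and> pairing u d = 0"
proof -
  obtain a b :: int where d: "d = (of_int a, of_int b)"
    using assms by (auto simp: lattice_N_def elim!: Ints_cases)
  hence "a \<noteq> 0 \<or> b \<noteq> 0" using assms(2) by (auto simp: zero_prod_def)
  then obtain a' b' where ab: "a = a' * gcd a b" "b = b' * gcd a b" "coprime a' b'"
    using gcd_coprime_exists [of a b] by auto
  have "b' * a = a' * b" by (subst ab(1), subst (2) ab(2)) simp
  hence "real_of_int b' * of_int a = of_int a' * of_int b" by (metis of_int_mult)
  hence "pairing (b', - a') d = 0" by (simp add: d pairing_def)
  moreover have "primitive_M (b', - a')"
    using ab(3) by (simp add: primitive_M_def coprime_commute)
  ultimately show ?thesis by blast
qed

lemma closed_segment_add_iff:
  fixes p a d :: "'a :: real_vector"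
  assumes "0 \<le> k"
  shows "p \<in> closed_segment a (a + k *\<^sub>R d) \<longleftrightarrow> (\<exists>t. 0 \<le> t \<and> t \<le> k \<and> p = a + t *\<^sub>R d)"
proof
  assume "p \<in> closed_segment a (a + k *\<^sub>R d)"
  then obtain s where s: "0 \<le> s" "s \<le> 1" "p = (1 - s) *\<^sub>R a + s *\<^sub>R (a + k *\<^sub>R d)"
    by (auto simp: closed_segment_def)
  have "p = a + (s * k) *\<^sub>R d" unfolding s(3) by (simp add: algebra_simps)
  moreover have "s * k \<le> k" using s assms by (simp add: mult_left_le_one_le)
  moreover have "0 \<le> s * k" using s assms by simp
  ultimately show "\<exists>t. 0 \<le> t \<and> t \<le> k \<and> p = a + t *\<^sub>R d" by blast
next
  assume "\<exists>t. 0 \<le> t \<and> t \<le> k \<and> p = a + t *\<^sub>R d"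
  then obtain t where t: "0 \<le> t" "t \<le> k" "p = a + t *\<^sub>R d" by blast
  show "p \<in> closed_segment a (a + k *\<^sub>R d)"
  proof (cases "k = 0")
    case False
    have "p = (1 - t / k) *\<^sub>R a + (t / k) *\<^sub>R (a + k *\<^sub>R d)"
      using False by (simp add: t(3) algebra_simps)
    moreover have "0 \<le> t / k" "t / k \<le> 1" using t assms False by auto
    ultimately show ?thesis unfolding closed_segment_def by blast
  qed (use t in auto)
qed

lemma width_segment:
  assumes "a \<in> lattice_N" "primitive_N d"
  shows "width (closed_segment a (a + of_nat k *\<^sub>R d)) = k"
proof -
  have nz: "d \<noteq> 0" using assms(2) by (auto simp: primitive_N_def zero_prod_def)
  have "closed_segment a (a + of_nat k *\<^sub>R d) \<inter> lattice_N = (\<lambda>i. a + of_nat i *\<^sub>R d) ` {..k}"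
    (is "?L = ?R")
  proof
    show "?L \<subseteq> ?R"
    proof
      fix p assume p: "p \<in> ?L"
      then obtain t where t: "0 \<le> t" "t \<le> of_nat k" "p = a + t *\<^sub>R d"
        by (auto simp: closed_segment_add_iff)
      have "t *\<^sub>R d \<in> lattice_N" using lattice_N_diff [of p a] p assms t by simp
      hence "t \<in> \<int>" using scaleR_primitive_lattice assms(2) by blast
      then obtain i :: nat where "t = of_nat i"
        using t(1) by (metis Ints_cases of_int_0_le_iff of_int_of_nat_eq zero_le_imp_eq_int)
      thus "p \<in> ?R" using t by auto
    qed
    show "?R \<subseteq> ?L"
    proof
      fix p assume "p \<in> ?R"
      then obtain i where i: "i \<le> k" "p = a + of_nat i *\<^sub>R d" by auto
      have "p \<in> closed_segment a (a + of_nat k *\<^sub>R d)"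
        unfolding closed_segment_add_iff [OF of_nat_0_le_iff] using i
        by (intro exI [of _ "of_nat i"]) simp
      moreover have "p \<in> lattice_N"
        unfolding i(2) by (intro lattice_N_add lattice_N_scaleR assms primitive_N_lattice) simp
      ultimately show "p \<in> ?L" by simp
    qed
  qed
  moreover have "inj_on (\<lambda>i. a + of_nat i *\<^sub>R d) {..k}" using nz by (auto simp: inj_on_def)
  ultimately show ?thesis by (simp add: width_def card_image)
qed

section \<open>Edges of a Fano polygon as faces cut out by primitive functionals\<close>

definition min_face :: "(real \<times> real) set \<Rightarrow> int \<times> int \<Rightarrow> (real \<times> real) set" where
  "min_face P u = {p \<in> P. \<forall>q\<in>P. pairing u p \<le> pairing u q}"

lemma fano_polygonD:
  assumes "fano_polygon P"
  shows fano_convex: "convex P" and fano_compact: "compact P" and fano_zero: "0 \<in> P"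
    and fano_bounded: "bounded P"
  using assms interior_subset [of P]
  by (auto simp: fano_polygon_def polytope_imp_convex polytope_imp_compact polytope_imp_bounded)

lemma fano_extreme_lattice:
  assumes "fano_polygon P" "v extreme_point_of P"
  shows "v \<in> lattice_N"
  using assms primitive_N_lattice unfolding fano_polygon_def by blast

lemma min_face_subset: "min_face P u \<subseteq> P"
  by (auto simp: min_face_def)

lemma min_face_eq:
  assumes "p \<in> min_face P u"
  shows "min_face P u = P \<inter> {q. pairing u q = pairing u p}"
  using assms by (fastforce simp: min_face_def)

lemma min_face_eqI:
  assumes "p \<in> P" "pairing u p = c" "\<And>q. q \<in> P \<Longrightarrow> c \<le> pairing u q"
  shows "min_face P u = {q \<in> P. pairing u q = c}"
  using assms by (fastforce simp: min_face_def)

lemma min_face_nonempty: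
  assumes "fano_polygon P"
  shows "min_face P u \<noteq> {}"
proof -
  have "\<exists>p\<in>P. \<forall>q\<in>P. pairing u p \<le> pairing u q"
    using fano_compact [OF assms] fano_zero [OF assms]
    by (intro continuous_attains_inf continuous_intros) auto
  thus ?thesis by (auto simp: min_face_def)
qed

text \<open>A small multiple of \<open>- u\<close>, read as a vector of the plane, lies in \<open>P\<close> and has a negative
  value.\<close>

lemma min_face_neg:
  assumes "fano_polygon P" "u \<noteq> 0" "p \<in> min_face P u"
  shows "pairing u p < 0"
proof -
  obtain e where e: "e > 0" "cball 0 e \<subseteq> P"
    using assms(1) by (auto simp: fano_polygon_def mem_interior_cball)
  define U :: "real \<times> real" where "U = (of_int (fst u), of_int (snd u))"
  have U: "U \<noteq> 0" using assms(2) by (cases u) (auto simp: U_def zero_prod_def)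
  define q where "q = - (e / norm U) *\<^sub>R U"
  have "norm q = e" using U e by (simp add: q_def)
  hence "q \<in> P" using e by auto
  hence "pairing u p \<le> pairing u q" using assms(3) by (auto simp: min_face_def)
  also have "\<dots> = - ((e / norm U) * (U \<bullet> U))"
    by (simp add: pairing_inner U_def [symmetric] q_def)
  also have "\<dots> < 0" using U e by simp
  finally show ?thesis .
qed

lemma min_face_face_of:
  assumes "fano_polygon P"
  shows "min_face P u face_of P"
proof -
  obtain p where p: "p \<in> min_face P u" using min_face_nonempty [OF assms] by blast
  have "P \<inter> {q. (of_int (fst u), of_int (snd u)) \<bullet> q = pairing u p} face_of P"
    using p fano_convex [OF assms]
    by (intro face_of_Int_supporting_hyperplane_ge) (auto simp: min_face_def pairing_inner [symmetric])
  thus ?thesis unfolding min_face_eq [OF p] by (simp add: pairing_inner)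
qed

text \<open>The vertices of the face are vertices of \<open>P\<close>, so they are lattice points on a line; the face
  is the segment between the first and the last of them.\<close>

lemma min_face_segment:
  assumes "fano_polygon P" "primitive_M u"
  obtains a k r where "a \<in> lattice_N" "0 < r" "pairing u a = - of_nat r"
    "min_face P u = closed_segment a (a + of_nat k *\<^sub>R perp u)"
proof -
  let ?F = "min_face P u"
  define X where "X = {v. v extreme_point_of ?F}"
  note face = min_face_face_of [OF assms(1), of u]
  have poly: "polytope ?F"
    using face_of_polytope_polytope [OF _ face] assms(1) by (simp add: fano_polygon_def)
  have hull: "?F = convex hull X"
    unfolding X_def by (intro Krein_Milman_Minkowski polytope_imp_compact polytope_imp_convex poly)
  have fin: "finite X"
    unfolding X_def by (intro finite_polyhedron_extreme_points polytope_imp_polyhedron poly)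
  have XF: "X \<subseteq> ?F" by (auto simp: X_def extreme_point_of_def)
  have XN: "X \<subseteq> lattice_N"
    using extreme_point_of_face [OF face] fano_extreme_lattice [OF assms(1)] by (auto simp: X_def)
  have "X \<noteq> {}" using hull min_face_nonempty [OF assms(1), of u] by auto
  then obtain a0 where a0: "a0 \<in> X" by blast
  have "\<exists>m :: int. v = a0 + of_int m *\<^sub>R perp u" if "v \<in> X" for v
  proof -
    have "pairing u (v - a0) = 0"
      using that a0 XF min_face_eq [of a0 P u] by (auto simp: pairing_linear)
    moreover have "v - a0 \<in> lattice_N" using that a0 XN lattice_N_diff by blast
    ultimately obtain m :: int where "v - a0 = of_int m *\<^sub>R perp u"
      using pairing_eq_0_imp_perp_lattice assms(2) by blast
    thus ?thesis by (intro exI [of _ m]) (simp add: algebra_simps)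
  qed
  then obtain \<mu> :: "real \<times> real \<Rightarrow> int"
    where \<mu>: "\<And>v. v \<in> X \<Longrightarrow> v = a0 + of_int (\<mu> v) *\<^sub>R perp u" by metis
  obtain a where a: "a \<in> X" "\<And>v. v \<in> X \<Longrightarrow> \<mu> a \<le> \<mu> v"
    using ex_min_if_finite [of "\<mu> ` X"] fin a0 by (metis (no_types, lifting) finite_imageI image_iff
      image_is_empty linorder_not_less \<open>X \<noteq> {}\<close>)
  obtain b where b: "b \<in> X" "\<And>v. v \<in> X \<Longrightarrow> \<mu> v \<le> \<mu> b"
    using Max_ge [of "\<mu> ` X"] Max_in [of "\<mu> ` X"] fin \<open>X \<noteq> {}\<close>
    by (metis (no_types, lifting) finite_imageI image_iff image_is_empty)
  define k where "k = nat (\<mu> b - \<mu> a)"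
  have k: "of_nat k = (of_int (\<mu> b) - of_int (\<mu> a) :: real)" using a(2) [OF b(1)] by (simp add: k_def)
  have shift: "v = a' + (x - y) *\<^sub>R perp u" if "v = a0 + x *\<^sub>R perp u" "a' = a0 + y *\<^sub>R perp u" for v a' x y
    using that by (simp add: algebra_simps)
  have bk: "b = a + of_nat k *\<^sub>R perp u"
    unfolding k by (rule shift [OF \<mu> [OF b(1)] \<mu> [OF a(1)]])
  have "?F = closed_segment a (a + of_nat k *\<^sub>R perp u)"
  proof
    have "X \<subseteq> closed_segment a (a + of_nat k *\<^sub>R perp u)"
    proof
      fix v assume v: "v \<in> X"
      have "v = a + (of_int (\<mu> v) - of_int (\<mu> a)) *\<^sub>R perp u"
        by (rule shift [OF \<mu> [OF v] \<mu> [OF a(1)]])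
      moreover have "0 \<le> (of_int (\<mu> v) - of_int (\<mu> a) :: real)"
        "(of_int (\<mu> v) - of_int (\<mu> a) :: real) \<le> of_nat k"
        using a(2) [OF v] b(2) [OF v] by (simp_all add: k)
      ultimately show "v \<in> closed_segment a (a + of_nat k *\<^sub>R perp u)"
        unfolding closed_segment_add_iff [OF of_nat_0_le_iff] by blast
    qed
    thus "?F \<subseteq> closed_segment a (a + of_nat k *\<^sub>R perp u)"
      unfolding hull by (intro hull_minimal convex_closed_segment)
    show "closed_segment a (a + of_nat k *\<^sub>R perp u) \<subseteq> ?F"
      using a(1) b(1) unfolding bk [symmetric] hull
      by (intro closed_segment_subset hull_inc convex_convex_hull)
  qed
  moreover obtain m :: int where m: "pairing u a = of_int m" using pairing_lattice XN a(1) by blast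
  have "m < 0" using min_face_neg [OF assms(1) primitive_M_nonzero [OF assms(2)]] a(1) XF m
    by (metis of_int_less_0_iff subsetD)
  hence "pairing u a = - of_nat (nat (- m))" "0 < nat (- m)" using m by auto
  ultimately show ?thesis using that a(1) XN by blast
qed

lemma min_face_edge:
  assumes "fano_polygon P" "primitive_M u" "p \<in> min_face P u" "q \<in> min_face P u" "p \<noteq> q"
  shows "min_face P u \<in> edges P"
proof -
  have "min_face P u \<subseteq> {x. (of_int (fst u), of_int (snd u)) \<bullet> x = pairing u p}"
    unfolding min_face_eq [OF assms(3)] by (auto simp: pairing_inner)
  hence "aff_dim (min_face P u) \<le> aff_dim {x :: real \<times> real. (of_int (fst u), of_int (snd u)) \<bullet> x = pairing u p}"
    by (rule aff_dim_subset)
  also have "\<dots> = 1"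
    using primitive_M_nonzero [OF assms(2)] by (cases u) (simp add: zero_prod_def)
  finally have "aff_dim (min_face P u) \<le> 1" .
  moreover have "aff_dim {p, q} \<le> aff_dim (min_face P u)"
    using assms by (intro aff_dim_subset) auto
  ultimately have "aff_dim (min_face P u) = 1" using assms(5) by (simp add: aff_dim_2)
  thus ?thesis using min_face_face_of [OF assms(1)] by (simp add: edges_def edge_of_def)
qed

text \<open>The only other primitive functional that is constant on the face is \<open>- u\<close>, and the value of
  that one on the face is positive, above its value at the origin.\<close>

lemma inner_normal_min_face:
  assumes "fano_polygon P" "primitive_M u" "p \<in> min_face P u" "q \<in> min_face P u" "p \<noteq> q"
  shows "inner_normal P (min_face P u) = u"
  unfolding inner_normal_def
proof (rule the_equality)
  show "primitive_M u \<and> (\<exists>c. (\<forall>v\<in>min_face P u. pairing u v = c) \<and> (\<forall>v\<in>P. c \<le> pairing u v))"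
    using assms min_face_eq [OF assms(3)] by (auto simp: min_face_def)
next
  fix w assume w: "primitive_M w \<and> (\<exists>c. (\<forall>v\<in>min_face P u. pairing w v = c) \<and> (\<forall>v\<in>P. c \<le> pairing w v))"
  then obtain c where c: "\<And>v. v \<in> min_face P u \<Longrightarrow> pairing w v = c" "\<And>v. v \<in> P \<Longrightarrow> c \<le> pairing w v"
    by blast
  have "pairing w (p - q) = 0" using c(1) assms by (simp add: pairing_linear)
  moreover have "pairing u (p - q) = 0" using min_face_eq [OF assms(3)] assms(4) by (simp add: pairing_linear)
  ultimately consider "w = u" | "w = - u"
    using primitive_M_same_kernel [of u w "p - q"] w assms by auto
  thus "w = u"
  proof cases
    case 2
    have "c \<le> 0" using c(2) [OF fano_zero [OF assms(1)]] by (simp add: pairing_zero)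
    moreover have "c = - pairing u p" using c(1) [OF assms(3)] 2 by (simp add: pairing_uminus)
    moreover have "pairing u p < 0"
      using min_face_neg assms primitive_M_nonzero by blast
    ultimately show ?thesis by simp
  qed
qed

text \<open>An edge is cut out by some real functional; it contains two lattice points, so the functional
  is a multiple of an integral one.\<close>

lemma edge_min_face:
  assumes "fano_polygon P" "E \<in> edges P"
  obtains u p q where "primitive_M u" "E = min_face P u" "inner_normal P E = u"
    "p \<in> E" "q \<in> E" "p \<noteq> q"
proof -
  have E: "E face_of P" "aff_dim E = 1" using assms(2) by (auto simp: edges_def edge_of_def)
  have pP: "polytope P" using assms(1) by (simp add: fano_polygon_def)
  have poly: "polytope E" using face_of_polytope_polytope pP E by blast
  have hull: "E = convex hull {v. v extreme_point_of E}"
    by (intro Krein_Milman_Minkowski polytope_imp_compact polytope_imp_convex poly)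
  have "\<exists>p q. p extreme_point_of E \<and> q extreme_point_of E \<and> p \<noteq> q"
  proof (rule ccontr)
    assume "\<not> ?thesis"
    hence "\<exists>p. {v. v extreme_point_of E} \<subseteq> {p}" by blast
    then obtain p where "{v. v extreme_point_of E} \<subseteq> {p}" by blast
    hence "E \<subseteq> {p}" using hull hull_minimal [of _ "{p}" convex] by (metis convex_singleton)
    hence "aff_dim E \<le> aff_dim {p}" by (rule aff_dim_subset)
    thus False using E(2) by simp
  qed
  then obtain p q where pq: "p extreme_point_of E" "q extreme_point_of E" "p \<noteq> q" by blast
  hence pqE: "p \<in> E" "q \<in> E" by (auto simp: extreme_point_of_def)
  have "p - q \<in> lattice_N"
    using pq extreme_point_of_face [OF E(1)] fano_extreme_lattice [OF assms(1)] lattice_N_diff by blast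
  then obtain u where u: "primitive_M u" "pairing u (p - q) = 0"
    using exists_primitive_annihilator pq(3) by (metis right_minus_eq)
  have "E exposed_face_of P"
    using exposed_face_of_polyhedron polytope_imp_polyhedron pP E(1) by blast
  then obtain A b where Ab: "P \<subseteq> {x. A \<bullet> x \<le> b}" "E = P \<inter> {x. A \<bullet> x = b}"
    by (auto simp: exposed_face_of_def)
  have "A \<noteq> 0"
  proof
    assume "A = 0"
    hence "E = P" using Ab pqE by auto
    moreover have "interior P \<noteq> {}" using assms(1) by (auto simp: fano_polygon_def)
    ultimately show False using E(2) aff_dim_nonempty_interior [of P] by simp
  qed
  obtain d1 d2 where d: "p - q = (d1, d2)" by (cases "p - q")
  obtain A1 A2 where A: "A = (A1, A2)" by (cases A)
  have "A \<bullet> (p - q) = 0" using Ab(2) pqE by (auto simp: inner_diff_right)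
  hence Ad: "A1 * d1 + A2 * d2 = 0" by (simp add: d A)
  obtain t where t: "p - q = t *\<^sub>R perp u" using pairing_eq_0_imp_perp [OF u] by blast
  have "t \<noteq> 0" using t pq(3) by auto
  have "d1 = - t * of_int (snd u)" "d2 = t * of_int (fst u)" using t d by (auto simp: perp_def)
  hence Au: "A1 * of_int (snd u) = A2 * of_int (fst u)" using Ad \<open>t \<noteq> 0\<close> by simp
  define U :: "real \<times> real" where "U = (of_int (fst u), of_int (snd u))"
  define s where "s = (A1 * of_int (fst u) + A2 * of_int (snd u)) / (U \<bullet> U)"
  have UU: "U \<bullet> U = (of_int (fst u))\<^sup>2 + (of_int (snd u))\<^sup>2" by (simp add: U_def power2_eq_square)
  have nz: "U \<bullet> U \<noteq> 0" using primitive_M_nonzero [OF u(1)] by (cases u) (auto simp: U_def zero_prod_def)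
  hence sU: "s * (U \<bullet> U) = A1 * of_int (fst u) + A2 * of_int (snd u)" by (simp add: s_def)
  have "A1 * (U \<bullet> U) = s * (U \<bullet> U) * of_int (fst u)" "A2 * (U \<bullet> U) = s * (U \<bullet> U) * of_int (snd u)"
    unfolding sU unfolding UU using Au by algebra+
  hence "A1 = s * of_int (fst u)" "A2 = s * of_int (snd u)" using nz by auto
  hence As: "A \<bullet> x = s * pairing u x" for x by (cases x) (simp add: A pairing_def algebra_simps)
  have "s \<noteq> 0" using \<open>A \<noteq> 0\<close> As by (metis inner_eq_zero_iff mult_zero_left)
  \<comment> \<open>\<open>A\<close> is an outer normal, so the inner normal has the opposite direction.\<close>
  define u' where "u' = (if s < 0 then u else - u)"
  have As': "A \<bullet> x = - \<bar>s\<bar> * pairing u' x" for x by (auto simp: As u'_def pairing_uminus)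
  have "E = min_face P u'"
  proof (rule sym, rule trans [OF min_face_eqI [of p]])
    show "p \<in> P" using pqE Ab by blast
    show "pairing u' p = - b / \<bar>s\<bar>" using pqE Ab(2) As' \<open>s \<noteq> 0\<close> by (auto simp: field_simps)
    show "- b / \<bar>s\<bar> \<le> pairing u' x" if "x \<in> P" for x
      using that Ab(1) As' [of x] \<open>s \<noteq> 0\<close> by (auto simp: field_simps)
    show "{q \<in> P. pairing u' q = - b / \<bar>s\<bar>} = E"
      unfolding Ab(2) using \<open>s \<noteq> 0\<close> by (auto simp: As' field_simps)
  qed
  moreover have "primitive_M u'" using u by (simp add: u'_def)
  ultimately show ?thesis using that inner_normal_min_face [OF assms(1)] pqE pq(3) by metis
qed

section \<open>Counting primitive T-cones by their inner normals\<close>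

text \<open>The number of primitive T-cones with inner normal \<open>u\<close>, expressed through the face on which
  \<open>u\<close> is minimal so that it makes sense, with value 0, when that face is only a vertex.\<close>

definition T_count :: "(real \<times> real) set \<Rightarrow> int \<times> int \<Rightarrow> nat" where
  "T_count P u = (if primitive_M u
     then width (min_face P u) div (THE r. \<forall>v\<in>min_face P u. pairing u v = - of_nat r) else 0)"

lemma T_count_segment:
  assumes "primitive_M u" "a \<in> lattice_N" "primitive_N d" "pairing u d = 0" "pairing u a = - of_nat r"
    and F: "min_face P u = closed_segment a (a + of_nat k *\<^sub>R d)"
  shows "T_count P u = k div r"
proof -
  have "\<forall>v\<in>min_face P u. pairing u v = - of_nat r"
    unfolding F using assms(4,5) by (auto simp: closed_segment_add_iff pairing_linear)
  moreover have "a \<in> min_face P u" unfolding F by simp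
  ultimately have "(THE r. \<forall>v\<in>min_face P u. pairing u v = - of_nat r) = r"
    using assms(5) by (intro the_equality) force+
  thus ?thesis using assms by (simp add: T_count_def F width_segment)
qed

lemma T_number_min_face:
  assumes "primitive_M u" "inner_normal P (min_face P u) = u"
  shows "T_number P (min_face P u) = T_count P u"
  using assms by (simp add: T_number_def height_def T_count_def)

lemma T_count_no_edge:
  assumes "fano_polygon P" "\<And>E. E \<in> edges P \<Longrightarrow> inner_normal P E \<noteq> u"
  shows "T_count P u = 0"
proof (cases "primitive_M u")
  case True
  then obtain a k r where F: "a \<in> lattice_N" "0 < r" "pairing u a = - of_nat r"
    "min_face P u = closed_segment a (a + of_nat k *\<^sub>R perp u)"
    using min_face_segment [OF assms(1)] by metis
  have "k = 0"
  proof (rule ccontr)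
    assume "k \<noteq> 0"
    hence "a \<noteq> a + of_nat k *\<^sub>R perp u" using perp_nonzero [OF True] by simp
    moreover have "a \<in> min_face P u" "a + of_nat k *\<^sub>R perp u \<in> min_face P u" by (simp_all add: F(4))
    ultimately show False
      using min_face_edge inner_normal_min_face assms True by metis
  qed
  thus ?thesis using T_count_segment [OF True F(1) primitive_N_perp [OF True] _ F(3,4)] by simp
qed (simp add: T_count_def)

text \<open>Cut the segment at the multiples of its height \<open>r\<close>. The residual segment is the last piece, which
  is cut off at the end of the edge, so that all pieces can be treated alike.\<close>

lemma T_subdivision_segment:
  assumes "primitive_N d" "a \<in> lattice_N" "E = closed_segment a (a + of_nat k *\<^sub>R d)" "0 < k"
    and h: "height P E = r" "0 < r"
  shows "\<exists>A R. T_subdivision P E A R"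
proof -
  have d: "d \<noteq> 0" using assms(1) by (auto simp: primitive_N_def zero_prod_def)
  have dN: "d \<in> lattice_N" using assms(1) by (rule primitive_N_lattice)
  have wE: "width E = k" using assms width_segment by simp
  define pt :: "real \<Rightarrow> real \<times> real" where "pt t = a + t *\<^sub>R d" for t
  have pt_inj: "pt s = pt t \<longleftrightarrow> s = t" for s t using d by (simp add: pt_def)
  define n k0 where "n = k div r" and "k0 = k mod r"
  have k: "k = n * r + k0" "k0 < r" using h by (simp_all add: n_def k0_def)
  define lo hi where "lo i = i * r" and "hi i = min (Suc i * r) k" for i
  define J where "J i = closed_segment (pt (of_nat (lo i))) (pt (of_nat (hi i)))" for i
  have Jmem: "p \<in> J i \<longleftrightarrow> (\<exists>t. of_nat (lo i) \<le> t \<and> t \<le> of_nat (hi i) \<and> p = pt t)"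
    if "lo i < hi i" for i p
  proof -
    have "pt (of_nat (hi i)) = pt (of_nat (lo i)) + (of_nat (hi i) - of_nat (lo i)) *\<^sub>R d"
      by (simp add: pt_def algebra_simps)
    hence "p \<in> J i \<longleftrightarrow> (\<exists>t. 0 \<le> t \<and> t \<le> of_nat (hi i) - of_nat (lo i) \<and> p = pt (of_nat (lo i)) + t *\<^sub>R d)"
      unfolding J_def using that by (simp only: closed_segment_add_iff)
    also have "\<dots> \<longleftrightarrow> (\<exists>t. 0 \<le> t \<and> t \<le> of_nat (hi i) - of_nat (lo i) \<and> p = pt (of_nat (lo i) + t))"
      by (simp add: pt_def algebra_simps)
    also have "\<dots> \<longleftrightarrow> (\<exists>t. of_nat (lo i) \<le> t \<and> t \<le> of_nat (hi i) \<and> p = pt t)"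
      (is "?l \<longleftrightarrow> ?r")
    proof
      assume ?l
      then obtain t where "0 \<le> t" "t \<le> of_nat (hi i) - of_nat (lo i)" "p = pt (of_nat (lo i) + t)" by blast
      thus ?r by (intro exI [of _ "of_nat (lo i) + t"]) auto
    next
      assume ?r
      then obtain t where "of_nat (lo i) \<le> t" "t \<le> of_nat (hi i)" "p = pt t" by blast
      thus ?l by (intro exI [of _ "t - of_nat (lo i)"]) auto
    qed
    finally show ?thesis .
  qed
  have Jint: "\<exists>t. of_nat (lo i) < t \<and> t < of_nat (hi i) \<and> p = pt t"
    if lh: "lo i < hi i" and ri: "p \<in> rel_interior (J i)" for i p
  proof -
    have ne: "pt (of_nat (lo i)) \<noteq> pt (of_nat (hi i))" using lh by (simp add: pt_inj)
    hence p: "p \<in> J i" "p \<noteq> pt (of_nat (lo i))" "p \<noteq> pt (of_nat (hi i))"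
      using ri by (auto simp: J_def rel_interior_closed_segment open_segment_def)
    then obtain t where t: "of_nat (lo i) \<le> t" "t \<le> of_nat (hi i)" "p = pt t"
      using Jmem [OF lh] by blast
    with p have "t \<noteq> of_nat (lo i)" "t \<noteq> of_nat (hi i)" by auto
    thus ?thesis using t by (intro exI [of _ t]) auto
  qed
  have lohi: "lo i < hi i" if "i < n \<or> i = n \<and> k0 \<noteq> 0" for i
  proof -
    have "i * r < k"
    proof (cases "i < n")
      case True
      hence "i * r < n * r" using h by simp
      thus ?thesis using k by linarith
    qed (use that k in auto)
    thus ?thesis using h by (simp add: lo_def hi_def)
  qed
  have hi_n: "hi i = Suc i * r" if "i < n" for i
  proof -
    have "Suc i * r \<le> n * r" using that by (intro mult_le_mono1) simp
    thus ?thesis using k by (simp add: hi_def)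
  qed
  have seg: "lattice_segment (J i) \<and> width (J i) = hi i - lo i" if "lo i < hi i" for i
  proof -
    have N: "pt (of_nat m) \<in> lattice_N" for m
      unfolding pt_def by (intro lattice_N_add lattice_N_scaleR dN assms) simp
    have "J i = closed_segment (pt (of_nat (lo i))) (pt (of_nat (lo i)) + of_nat (hi i - lo i) *\<^sub>R d)"
      using that by (simp add: J_def pt_def algebra_simps of_nat_diff)
    hence "width (J i) = hi i - lo i" using width_segment [OF N assms(1)] by simp
    moreover have "pt (of_nat (lo i)) \<noteq> pt (of_nat (hi i))" using that by (simp add: pt_inj)
    hence "lattice_segment (J i)" unfolding lattice_segment_def J_def using N by blast
    ultimately show ?thesis by simp
  qed
  have disj: "rel_interior (J i) \<inter> rel_interior (J j) = {}"
    if "lo i < hi i" "lo j < hi j" "i < j" for i j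
  proof -
    have "hi i \<le> lo j"
    proof -
      have "Suc i * r \<le> j * r" using that by (intro mult_le_mono1) simp
      thus ?thesis by (simp add: hi_def lo_def)
    qed
    hence "(of_nat (hi i) :: real) \<le> of_nat (lo j)" by simp
    moreover have "of_nat (lo j) < (of_nat (hi i) :: real)"
      if p: "p \<in> rel_interior (J i)" "p \<in> rel_interior (J j)" for p
    proof -
      obtain s where s: "s < of_nat (hi i)" "p = pt s" using Jint [OF \<open>lo i < hi i\<close> p(1)] by blast
      obtain t where t: "of_nat (lo j) < t" "p = pt t" using Jint [OF \<open>lo j < hi j\<close> p(2)] by blast
      have "s = t" using s(2) t(2) pt_inj by metis
      thus ?thesis using s t by simp
    qed
    ultimately show ?thesis by force
  qed
  define I where "I = {i. i < n \<or> i = n \<and> k0 \<noteq> 0}"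
  have I: "lo i < hi i" if "i \<in> I" for i using that lohi by (simp add: I_def)
  define A R where "A = J ` {..<n}" and "R = (if k0 = 0 then {} else {J n})"
  have AR: "A \<union> R = J ` I" by (auto simp: A_def R_def I_def)
  have pw: "pairwise (\<lambda>s t. rel_interior s \<inter> rel_interior t = {}) (A \<union> R)"
    unfolding AR pairwise_image
  proof (clarsimp simp: pairwise_def)
    fix i j assume "i \<in> I" "j \<in> I" "J i \<noteq> J j"
    thus "rel_interior (J i) \<inter> rel_interior (J j) = {}"
      using disj [of i j] disj [of j i] I by (metis Int_commute linorder_neqE_nat)
  qed
  have inj: "inj_on J {..<n}"
  proof -
    have "J i \<noteq> J j" if "i < j" "j < n" for i j
    proof -
      have l: "lo i < hi i" "lo j < hi j" using that lohi by auto
      have "pt (of_nat (lo i)) \<in> J i" by (simp add: J_def)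
      moreover have "lo i < lo j" using that h by (simp add: lo_def)
      hence "pt (of_nat (lo i)) \<notin> J j" unfolding Jmem [OF l(2)] pt_inj by auto
      ultimately show ?thesis by blast
    qed
    thus ?thesis by (metis (no_types, lifting) inj_onI lessThan_iff linorder_neqE_nat)
  qed
  have "\<Union>(A \<union> R) = E"
  proof
    have Emem: "p \<in> E \<longleftrightarrow> (\<exists>t. 0 \<le> t \<and> t \<le> of_nat k \<and> p = pt t)" for p
      unfolding assms(3) pt_def by (rule closed_segment_add_iff) simp
    show "\<Union>(A \<union> R) \<subseteq> E"
    proof
      fix p assume "p \<in> \<Union>(A \<union> R)"
      then obtain i where i: "i \<in> I" "p \<in> J i" unfolding AR by blast
      then obtain t where t: "of_nat (lo i) \<le> t" "t \<le> of_nat (hi i)" "p = pt t"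
        using Jmem [OF I] by metis
      have "(of_nat (hi i) :: real) \<le> of_nat k" by (simp add: hi_def)
      with t have "0 \<le> t" "t \<le> of_nat k" by linarith+
      thus "p \<in> E" using Emem t(3) by blast
    qed
    show "E \<subseteq> \<Union>(A \<union> R)"
    proof
      fix p assume "p \<in> E"
      then obtain t where t: "0 \<le> t" "t \<le> of_nat k" "p = pt t" using Emem by blast
      \<comment> \<open>The far end point of the edge belongs to the last segment although the floor is too big
        there when there is no residual segment.\<close>
      define i where "i = (if t < of_nat k \<or> k0 \<noteq> 0 then nat \<lfloor>t / of_nat r\<rfloor> else n - 1)"
      have "i \<in> I \<and> of_nat (lo i) \<le> t \<and> t \<le> of_nat (hi i)"
      proof (cases "t < of_nat k \<or> k0 \<noteq> 0")
        case True
        hence i: "i = nat \<lfloor>t / of_nat r\<rfloor>" by (simp add: i_def)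
        have fl: "of_nat i \<le> t / of_nat r" "t / of_nat r < of_nat i + 1"
          unfolding i using t by (auto simp: of_nat_nat)
        hence b: "of_nat (i * r) \<le> t" "t < of_nat (Suc i * r)"
          using h by (auto simp: field_simps)
        hence ik: "i * r \<le> k" using t(2) by (metis dual_order.trans of_nat_le_iff)
        have "i \<le> n" unfolding n_def using ik h by (simp add: less_eq_div_iff_mult_less_eq)
        moreover have "k0 \<noteq> 0" if "i = n"
          using True
        proof
          assume "t < of_nat k"
          with b have "(of_nat (i * r) :: real) < of_nat k" by linarith
          hence "i * r < k" by (simp only: of_nat_less_iff)
          thus ?thesis using k that by auto
        qed
        ultimately have "i \<in> I" by (auto simp: I_def)
        thus ?thesis using b t by (auto simp: lo_def hi_def min_def)
      next
        case False
        hence tk: "t = of_nat k" "k0 = 0" "i = n - 1" using t by (auto simp: i_def)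
        have "n \<noteq> 0" using k assms(4) tk(2) by auto
        hence "i \<in> I" "k = Suc i * r" using k tk by (auto simp: I_def)
        thus ?thesis using tk(1) by (simp add: lo_def hi_def)
      qed
      thus "p \<in> \<Union>(A \<union> R)" unfolding AR using Jmem [OF I] t(3) by (metis (no_types, lifting) UN_I)
    qed
  qed
  moreover have "card A = T_number P E"
    using inj by (simp add: A_def card_image T_number_def wE h n_def)
  moreover have "\<forall>s\<in>A. lattice_segment s \<and> width s = height P E"
    using seg lohi hi_n by (auto simp: A_def h lo_def)
  moreover have "card R = (if residual_width P E = 0 then 0 else 1)"
    "\<forall>s\<in>R. lattice_segment s \<and> width s = residual_width P E"
  proof -
    have res: "residual_width P E = k0" by (simp add: residual_width_def wE h k0_def)
    show "card R = (if residual_width P E = 0 then 0 else 1)" by (simp add: R_def res)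
    have "hi n - lo n = k0" using k by (simp add: hi_def lo_def)
    thus "\<forall>s\<in>R. lattice_segment s \<and> width s = residual_width P E"
      using seg [of n] lohi [of n] by (simp add: R_def res)
  qed
  moreover have "finite A" "finite R" by (auto simp: A_def R_def)
  ultimately show ?thesis unfolding T_subdivision_def using pw by blast
qed

lemma T_subdivision_exists:
  assumes "fano_polygon P" "E \<in> edges P"
  shows "\<exists>A R. T_subdivision P E A R"
proof -
  obtain u p q where u: "primitive_M u" "E = min_face P u" "inner_normal P E = u"
    "p \<in> E" "q \<in> E" "p \<noteq> q"
    using edge_min_face [OF assms] by metis
  obtain a k r where F: "a \<in> lattice_N" "0 < r" "pairing u a = - of_nat r"
    "min_face P u = closed_segment a (a + of_nat k *\<^sub>R perp u)"
    using min_face_segment [OF assms(1) u(1)] by metis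
  have aE: "a \<in> E" using F(4) u(2) by simp
  have "height P E = r"
    unfolding height_def u(3)
  proof (rule the_equality)
    show "\<forall>v\<in>E. pairing u v = - of_nat r" using aE min_face_eq [of a P u] F(3) u(2) by auto
    show "r' = r" if "\<forall>v\<in>E. pairing u v = - of_nat r'" for r' using that aE F(3) by force
  qed
  moreover have "k \<noteq> 0" using u(4-6) F(4) u(2) by (metis add.right_neutral closed_segment_idem of_nat_0 scaleR_zero_left singletonD)
  ultimately show ?thesis
    using T_subdivision_segment [OF primitive_N_perp [OF u(1)] F(1)] F(2,4) u(2) by blast
qed

text \<open>A piece of an edge is recovered from the cone over it, so different pieces have different cones.\<close>

lemma cone_hull_level:
  assumes "\<And>x. x \<in> s \<Longrightarrow> pairing u x = c" "c \<noteq> 0"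
  shows "{x \<in> cone hull s. pairing u x = c} = s"
proof -
  have "x \<in> s" if "x \<in> cone hull s" "pairing u x = c" for x
  proof -
    obtain t y where t: "y \<in> s" "x = t *\<^sub>R y" using \<open>x \<in> cone hull s\<close> unfolding cone_hull_expl by blast
    hence "t * c = c" using that assms(1) by (simp add: pairing_linear)
    thus ?thesis using t assms(2) by simp
  qed
  thus ?thesis using assms(1) hull_subset [of s cone] by blast
qed

text \<open>If a second edge \<open>E'\<close> has the cone over \<open>s\<close> inside its own cone, comparing the values of the
  two normals shows that \<open>s\<close> lies on \<open>E'\<close>; then both normals are constant along \<open>s\<close> and coincide.\<close>

lemma determined_edge_cone_hull:
  assumes "fano_polygon P" "E \<in> edges P" "s \<subseteq> E" "lattice_segment s"
  shows "determined_edge P (cone hull s) = E"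
  unfolding determined_edge_def
proof (rule the_equality)
  show "E \<in> edges P \<and> cone hull s \<subseteq> cone hull E" using assms hull_mono [OF assms(3)] by blast
next
  fix E' assume E': "E' \<in> edges P \<and> cone hull s \<subseteq> cone hull E'"
  obtain u where u: "primitive_M u" "E = min_face P u" using edge_min_face [OF assms(1,2)] by metis
  obtain u' where u': "primitive_M u'" "E' = min_face P u'" using edge_min_face [OF assms(1)] E' by metis
  have "s \<subseteq> E'"
  proof
    fix p assume p: "p \<in> s"
    hence "p \<in> cone hull E'" using E' hull_subset [of s cone] by blast
    then obtain t x where t: "0 \<le> t" "x \<in> E'" "p = t *\<^sub>R x" unfolding cone_hull_expl by blast
    have pE: "p \<in> min_face P u" using p assms(3) u(2) by blast
    have xE: "x \<in> min_face P u'" using t u'(2) by blast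
    have "pairing u p < 0" "pairing u' x < 0"
      using min_face_neg [OF assms(1)] pE xE u u' primitive_M_nonzero by blast+
    moreover have "pairing u p \<le> pairing u x" "pairing u' x \<le> pairing u' p"
      using pE xE by (auto simp: min_face_def)
    hence "t * pairing u x \<le> pairing u x" "pairing u' x \<le> t * pairing u' x" by (auto simp: t pairing_linear)
    moreover have "pairing u p = t * pairing u x" by (simp add: t pairing_linear)
    ultimately have "t = 1"
    proof -
      assume a: "pairing u p < 0" "pairing u' x < 0" "t * pairing u x \<le> pairing u x"
        "pairing u' x \<le> t * pairing u' x" "pairing u p = t * pairing u x"
      have "pairing u x < 0" using a(1,5) t(1) by (simp add: mult_less_0_iff)
      have "(t - 1) * pairing u x \<le> 0" "0 \<le> (t - 1) * pairing u' x" using a by (auto simp: algebra_simps)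
      thus "t = 1" using \<open>pairing u x < 0\<close> a(2) by (auto simp: mult_le_0_iff zero_le_mult_iff)
    qed
    thus "p \<in> E'" using t by simp
  qed
  moreover obtain p q where pq: "p \<in> s" "q \<in> s" "p \<noteq> q"
    using assms(4) unfolding lattice_segment_def by (metis ends_in_segment(1,2))
  ultimately have m: "p \<in> min_face P u" "q \<in> min_face P u" "p \<in> min_face P u'" "q \<in> min_face P u'"
    using assms(3) u u' by blast+
  have "pairing u (p - q) = 0" "pairing u' (p - q) = 0"
    using min_face_eq [OF m(1)] min_face_eq [OF m(3)] m by (auto simp: pairing_linear)
  hence "u' = u \<or> u' = - u" using primitive_M_same_kernel u u' pq by (metis right_minus_eq)
  moreover have "pairing u p < 0" "pairing u' p < 0"
    using min_face_neg [OF assms(1)] m u u' primitive_M_nonzero by blast+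
  ultimately show "E' = E" using u u' by (auto simp: pairing_uminus)
qed

lemma primitive_T_cones_exist:
  assumes "fano_polygon P"
  shows "\<exists>\<T>. primitive_T_cones P \<T>"
  using T_subdivision_exists [OF assms] unfolding primitive_T_cones_def by metis

text \<open>A cone remembers its segment and its edge, and an edge is determined by its inner normal; so the
  cones with normal \<open>u\<close> correspond to the segments of a single edge, whatever the subdivisions are.\<close>

lemma primitive_T_cones_count:
  assumes "fano_polygon P" "primitive_T_cones P \<T>"
  shows "finite \<T>"
    and "count {#inner_normal P (determined_edge P C). C \<in># mset_set \<T>#} u = T_count P u"
proof -
  obtain A R where AR: "\<And>E. E \<in> edges P \<Longrightarrow> T_subdivision P E (A E) (R E)"
    and T: "\<T> = (\<Union>E\<in>edges P. (\<lambda>s. cone hull s) ` A E)"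
    using assms(2) unfolding primitive_T_cones_def by blast
  have finE: "finite (edges P)"
    using finite_polytope_faces [of P] assms(1)
    by (auto simp: edges_def edge_of_def fano_polygon_def elim: rev_finite_subset)
  have A: "finite (A E)" "card (A E) = T_number P E" "\<And>s. s \<in> A E \<Longrightarrow> lattice_segment s \<and> s \<subseteq> E"
    if "E \<in> edges P" for E
    using AR [OF that] unfolding T_subdivision_def by auto
  show fin: "finite \<T>" unfolding T using finE A(1) by blast
  let ?f = "\<lambda>C. inner_normal P (determined_edge P C)"
  have f: "?f (cone hull s) = inner_normal P E" if "E \<in> edges P" "s \<in> A E" for E s
    using determined_edge_cone_hull [OF assms(1) that(1)] A(3) [OF that] by simp
  have "count {#?f C. C \<in># mset_set \<T>#} u = card {C \<in> \<T>. ?f C = u}"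
    using fin by (simp add: count_image_mset vimage_def Int_def conj_commute)
  also have "\<dots> = T_count P u"
  proof (cases "\<exists>E\<in>edges P. inner_normal P E = u")
    case True
    then obtain E where E: "E \<in> edges P" "inner_normal P E = u" by blast
    then have prim: "primitive_M u" "E = min_face P u" using edge_min_face [OF assms(1)] by metis+
    have unique: "E' = E" if "E' \<in> edges P" "inner_normal P E' = u" for E'
      using edge_min_face [OF assms(1) that(1)] that(2) prim by metis
    have eq: "{C \<in> \<T>. ?f C = u} = (\<lambda>s. cone hull s) ` A E"
    proof
      show "{C \<in> \<T>. ?f C = u} \<subseteq> (\<lambda>s. cone hull s) ` A E" using f unique unfolding T by auto
      show "(\<lambda>s. cone hull s) ` A E \<subseteq> {C \<in> \<T>. ?f C = u}" using f E unfolding T by auto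
    qed
    obtain p where p: "p \<in> min_face P u" using min_face_nonempty [OF assms(1)] by blast
    have "inj_on (\<lambda>s. cone hull s) (A E)"
    proof (rule inj_onI)
      fix s t assume st: "s \<in> A E" "t \<in> A E" "cone hull s = cone hull t"
      have "s' = {x \<in> cone hull s'. pairing u x = pairing u p}" if "s' \<in> A E" for s'
      proof (rule cone_hull_level [symmetric])
        show "pairing u x = pairing u p" if "x \<in> s'" for x
          using that A(3) [OF E(1) \<open>s' \<in> A E\<close>] min_face_eq [OF p] prim(2) by blast
        show "pairing u p \<noteq> 0"
          using min_face_neg [OF assms(1) primitive_M_nonzero [OF prim(1)] p] by simp
      qed
      thus "s = t" using st by metis
    qed
    hence "card {C \<in> \<T>. ?f C = u} = T_number P E" unfolding eq by (simp add: card_image A E)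
    thus ?thesis using T_number_min_face prim E(2) by metis
  next
    case False
    hence "{C \<in> \<T>. ?f C = u} = {}" using f unfolding T by auto
    thus ?thesis using T_count_no_edge [OF assms(1)] False by (metis card.empty)
  qed
  finally show "count {#?f C. C \<in># mset_set \<T>#} u = T_count P u" .
qed

lemma T_cone_normalsI:
  assumes "fano_polygon P" "\<And>u. count X u = T_count P u"
  shows "T_cone_normals P X"
  unfolding T_cone_normals_def
  using primitive_T_cones_exist primitive_T_cones_count assms by (auto intro!: multiset_eqI)

section \<open>Shearing one half of a polygon\<close>

definition shear :: "int \<times> int \<Rightarrow> real \<times> real \<Rightarrow> real \<times> real \<Rightarrow> real \<times> real" where
  "shear w v p = p + pairing w p *\<^sub>R v"

text \<open>The points that lie to the right of a point of \<open>P\<close> and to the left of a point of the sheared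
  polygon, on a line in the direction \<open>v\<close>: on each such line the left end point is that of \<open>P\<close> and
  the right end point is moved by the shear.\<close>

definition half_shear :: "(real \<times> real) set \<Rightarrow> int \<times> int \<Rightarrow> real \<times> real \<Rightarrow> (real \<times> real) set" where
  "half_shear P w v = {p. (\<exists>t\<ge>0. p - t *\<^sub>R v \<in> P) \<and> (\<exists>t\<ge>0. p + (t - pairing w p) *\<^sub>R v \<in> P)}"

definition leftmost :: "(real \<times> real) set \<Rightarrow> real \<times> real \<Rightarrow> real \<times> real \<Rightarrow> bool" where
  "leftmost P v p \<longleftrightarrow> p \<in> P \<and> (\<forall>t>0. p - t *\<^sub>R v \<notin> P)"

lemma shear_inverse:
  assumes "pairing w v = 0"
  shows "shear w v (shear w (- v) p) = p" "shear w (- v) (shear w v p) = p"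
  using assms by (simp_all add: shear_def pairing_add pairing_diff pairing_scaleR)

lemma linear_shear: "linear (shear w v)"
  by (rule linearI) (simp_all add: shear_def pairing_linear algebra_simps)

lemma shear_lattice:
  assumes "v \<in> lattice_N" "p \<in> lattice_N"
  shows "shear w v p \<in> lattice_N"
  unfolding shear_def using pairing_lattice [OF assms(2)] assms
  by (metis Ints_of_int lattice_N_add lattice_N_scaleR)

lemma lattice_N_uminus: "v \<in> lattice_N \<Longrightarrow> - v \<in> lattice_N"
  by (auto simp: lattice_N_def)

lemma shear_image_lattice:
  assumes "v \<in> lattice_N" "pairing w v = 0"
  shows "shear w v ` lattice_N = lattice_N"
proof
  show "shear w v ` lattice_N \<subseteq> lattice_N" using shear_lattice assms by blast
  show "lattice_N \<subseteq> shear w v ` lattice_N"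
  proof
    fix p assume "p \<in> lattice_N"
    hence "shear w (- v) p \<in> lattice_N" using shear_lattice lattice_N_uminus assms by blast
    thus "p \<in> shear w v ` lattice_N" using shear_inverse(1) [OF assms(2)] by (metis imageI)
  qed
qed

lemma shear_GL2Z: "v \<in> lattice_N \<Longrightarrow> pairing w v = 0 \<Longrightarrow> shear w v \<in> GL2Z"
  by (simp add: GL2Z_def linear_shear shear_image_lattice)

lemma inj_shear: "pairing w v = 0 \<Longrightarrow> inj (shear w v)"
  by (metis injI shear_inverse(2))

text \<open>A common divisor of the coordinates of the sheared point divides the value of \<open>w\<close>, which the
  shear preserves.\<close>

lemma primitive_N_shear:
  assumes "primitive_N p" "v \<in> lattice_N" "pairing w v = 0"
  shows "primitive_N (shear w v p)"
proof -
  obtain a b :: int where p: "p = (of_int a, of_int b)" "coprime a b"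
    using assms(1) by (auto simp: primitive_N_def)
  obtain c d :: int where v: "v = (of_int c, of_int d)"
    using assms(2) by (auto simp: lattice_N_def elim!: Ints_cases)
  obtain w1 w2 where w: "w = (w1, w2)" by (cases w)
  define m where "m = w1 * a + w2 * b"
  have "real_of_int (w1 * c + w2 * d) = 0" using assms(3) by (simp add: w v pairing_def)
  hence wv: "w1 * c + w2 * d = 0" by (simp only: of_int_eq_0_iff)
  have "coprime (a + m * c) (b + m * d)"
  proof (rule coprimeI)
    fix g assume g: "g dvd a + m * c" "g dvd b + m * d"
    have "m = w1 * (a + m * c) + w2 * (b + m * d)" using wv unfolding m_def by algebra
    hence "g dvd m" using g by (metis dvd_add dvd_mult)
    hence "g dvd a" "g dvd b" using g by (simp_all add: dvd_add_left_iff)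
    thus "is_unit g" using p(2) coprime_common_divisor by blast
  qed
  moreover have "shear w v p = (of_int (a + m * c), of_int (b + m * d))"
    by (simp add: shear_def p v w pairing_def m_def)
  ultimately show ?thesis unfolding primitive_N_def by blast
qed

lemma half_shear_uminus:
  assumes "pairing w v = 0"
  shows "shear w v ` half_shear P w (- v) = half_shear P w v"
proof -
  have eq: "shear w (- v) p \<in> half_shear P w (- v) \<longleftrightarrow> p \<in> half_shear P w v" for p
  proof -
    let ?q = "shear w (- v) p"
    have q: "?q = p - pairing w p *\<^sub>R v" "pairing w ?q = pairing w p"
      using assms by (simp_all add: shear_def pairing_linear)
    have "?q - t *\<^sub>R (- v) = p + (t - pairing w p) *\<^sub>R v" for t unfolding q by (simp add: algebra_simps)
    moreover have "?q + (t - pairing w ?q) *\<^sub>R (- v) = p - t *\<^sub>R v" for t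
      unfolding q(2) unfolding q(1) by (simp add: algebra_simps)
    ultimately show ?thesis unfolding half_shear_def by auto
  qed
  show ?thesis
  proof
    show "shear w v ` half_shear P w (- v) \<subseteq> half_shear P w v"
      using eq shear_inverse(2) [OF assms] by (metis (no_types, lifting) image_subsetI)
    show "half_shear P w v \<subseteq> shear w v ` half_shear P w (- v)"
      using eq shear_inverse(1) [OF assms] by (metis (no_types, lifting) image_eqI subsetI)
  qed
qed

lemma convex_half_shear:
  assumes "convex P"
  shows "convex (half_shear P w v)"
proof (rule convexI)
  fix p q and x y :: real
  assume pq: "p \<in> half_shear P w v" "q \<in> half_shear P w v" and xy: "0 \<le> x" "0 \<le> y" "x + y = 1"
  obtain t t' where t: "0 \<le> t" "p - t *\<^sub>R v \<in> P" "0 \<le> t'" "p + (t' - pairing w p) *\<^sub>R v \<in> P"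
    using pq(1) by (auto simp: half_shear_def)
  obtain s s' where s: "0 \<le> s" "q - s *\<^sub>R v \<in> P" "0 \<le> s'" "q + (s' - pairing w q) *\<^sub>R v \<in> P"
    using pq(2) by (auto simp: half_shear_def)
  have "x *\<^sub>R (p - t *\<^sub>R v) + y *\<^sub>R (q - s *\<^sub>R v) \<in> P"
    using convexD [OF assms t(2) s(2) xy] .
  hence "x *\<^sub>R p + y *\<^sub>R q - (x * t + y * s) *\<^sub>R v \<in> P" by (simp add: algebra_simps)
  moreover have "x *\<^sub>R (p + (t' - pairing w p) *\<^sub>R v) + y *\<^sub>R (q + (s' - pairing w q) *\<^sub>R v) \<in> P"
    using convexD [OF assms t(4) s(4) xy] .
  hence "x *\<^sub>R p + y *\<^sub>R q + ((x * t' + y * s') - pairing w (x *\<^sub>R p + y *\<^sub>R q)) *\<^sub>R v \<in> P"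
    by (simp add: algebra_simps pairing_add pairing_scaleR)
  moreover have "0 \<le> x * t + y * s" "0 \<le> x * t' + y * s'" using t s xy by auto
  ultimately show "x *\<^sub>R p + y *\<^sub>R q \<in> half_shear P w v" unfolding half_shear_def by blast
qed

text \<open>\<open>v\<close> is one of the two horizontal directions; results about \<open>v\<close> transfer to \<open>- v\<close> by the lemma
  \<open>opposite\<close>. The condition \<open>wide\<close> says that the face of \<open>P\<close> on which \<open>w\<close> is minimal contains a segment
  whose lattice length is the height of that face. This is what makes a mutation possible.\<close>

locale wide_polygon =
  fixes P :: "(real \<times> real) set" and w :: "int \<times> int" and v :: "real \<times> real"
  assumes fano: "fano_polygon P" and prim_w: "primitive_M w" and prim_v: "primitive_N v"
    and wv: "pairing w v = 0"
    and wide: "\<exists>a\<in>min_face P w. a - pairing w a *\<^sub>R v \<in> P"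
begin

lemma v_nonzero: "v \<noteq> 0"
  using prim_v by (auto simp: primitive_N_def zero_prod_def)

lemma v_lattice: "v \<in> lattice_N"
  using prim_v by (rule primitive_N_lattice)

lemma pairing_shift: "pairing w (p + t *\<^sub>R v) = pairing w p" "pairing w (p - t *\<^sub>R v) = pairing w p"
  by (simp_all add: pairing_linear wv)

lemma opposite: "wide_polygon P w (- v)"
proof
  obtain a where a: "a \<in> min_face P w" "a - pairing w a *\<^sub>R v \<in> P" using wide by blast
  let ?b = "a - pairing w a *\<^sub>R v"
  have "?b \<in> min_face P w" using a by (simp add: min_face_eq [OF a(1)] pairing_shift)
  moreover have "?b - pairing w ?b *\<^sub>R (- v) \<in> P"
    using subsetD [OF min_face_subset a(1)] by (simp add: pairing_shift)
  ultimately show "\<exists>a\<in>min_face P w. a - pairing w a *\<^sub>R (- v) \<in> P" by blast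
  show "primitive_N (- v)"
  proof -
    obtain a b :: int where "v = (of_int a, of_int b)" "coprime a b"
      using prim_v by (auto simp: primitive_N_def)
    thus ?thesis unfolding primitive_N_def by (intro exI [of _ "- a"] exI [of _ "- b"]) simp
  qed
  show "pairing w (- v) = 0" using wv by (simp add: pairing_def)
qed (rule fano prim_w)+

lemma same_level:
  assumes "pairing w p = pairing w q"
  obtains s where "q = p + s *\<^sub>R v"
proof -
  obtain t where t: "q - p = t *\<^sub>R perp w"
    using pairing_eq_0_imp_perp [OF prim_w, of "q - p"] assms by (auto simp: pairing_linear)
  hence q: "q = p + t *\<^sub>R perp w" by (metis add.commute diff_add_cancel)
  consider "v = perp w" | "v = - perp w" using primitive_N_eq_perp [OF prim_w prim_v wv] by blast
  thus ?thesis
  proof cases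
    case 1
    thus ?thesis using that q by blast
  next
    case 2
    thus ?thesis using that [of "- t"] q by simp
  qed
qed

text \<open>Compactness gives a point of the line on which the inner product with \<open>v\<close> is minimal.\<close>

lemma leftmost_exists:
  assumes "p \<in> P"
  shows "\<exists>t\<ge>0. leftmost P v (p - t *\<^sub>R v)"
proof -
  let ?K = "P \<inter> {q. pairing w q = pairing w p}"
  have "closed {q. pairing w q = pairing w p}"
    by (intro closed_Collect_eq continuous_intros)
  hence "compact ?K" by (rule compact_Int_closed [OF fano_compact [OF fano]])
  moreover have "?K \<noteq> {}" using assms by blast
  ultimately obtain q where q: "q \<in> ?K" "\<And>q'. q' \<in> ?K \<Longrightarrow> q \<bullet> v \<le> q' \<bullet> v"
    using continuous_attains_inf [of ?K "\<lambda>q. q \<bullet> v"] by (force intro: continuous_intros)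
  have vv: "0 < v \<bullet> v" using v_nonzero by simp
  obtain s where s: "p = q + s *\<^sub>R v" using same_level [of q p] q(1) by auto
  have "q \<bullet> v \<le> p \<bullet> v" using q(2) assms by blast
  hence "0 \<le> s" using vv by (simp add: s inner_add_left zero_le_mult_iff)
  moreover have "leftmost P v (p - s *\<^sub>R v)"
    unfolding leftmost_def
  proof (intro conjI allI impI)
    show "p - s *\<^sub>R v \<in> P" using q(1) s by simp
    fix t :: real assume "0 < t"
    hence "(q - t *\<^sub>R v) \<bullet> v < q \<bullet> v" using vv by (simp add: inner_diff_left)
    moreover have "pairing w (q - t *\<^sub>R v) = pairing w p" using q(1) by (simp add: pairing_shift)
    ultimately have "q - t *\<^sub>R v \<notin> P" using q(2) [of "q - t *\<^sub>R v"] by auto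
    thus "p - s *\<^sub>R v - t *\<^sub>R v \<notin> P" using s by simp
  qed
  ultimately show ?thesis by blast
qed

text \<open>By convexity \<open>P\<close> contains the triangle spanned by the origin and the segment in the bottom
  edge, hence a segment of length \<open>-h\<close> at every level \<open>h < 0\<close> that it reaches. This keeps the left end point of
  a line to the left of the moved right end point.\<close>

lemma leftmost_shift:
  assumes "leftmost P v p"
  shows "\<exists>t\<ge>0. p + (t - pairing w p) *\<^sub>R v \<in> P"
proof (cases "0 \<le> pairing w p")
  case True
  thus ?thesis using assms by (intro exI [of _ "pairing w p"]) (simp add: leftmost_def)
next
  case False
  obtain a where a: "a \<in> min_face P w" "a - pairing w a *\<^sub>R v \<in> P" using wide by blast
  have p: "p \<in> P" using assms by (simp add: leftmost_def)
  hence le: "pairing w a \<le> pairing w p" using a by (simp add: min_face_def)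
  define c where "c = pairing w p / pairing w a"
  have c: "0 \<le> c" "c \<le> 1" "c * pairing w a = pairing w p"
    using le False by (auto simp: c_def divide_le_eq zero_le_divide_iff)
  have P: "c *\<^sub>R x \<in> P" if "x \<in> P" for x
    using convexD [OF fano_convex [OF fano] that fano_zero [OF fano], of c "1 - c"] c by simp
  have "c *\<^sub>R a \<in> P" using P a min_face_subset by blast
  have "pairing w p = pairing w (c *\<^sub>R a)" by (simp add: pairing_linear c)
  then obtain s where s: "c *\<^sub>R a = p + s *\<^sub>R v" using same_level by blast
  have "0 \<le> s"
  proof (rule ccontr)
    assume "\<not> 0 \<le> s"
    hence "p - (- s) *\<^sub>R v \<notin> P" using assms unfolding leftmost_def by (metis neg_0_less_iff_less not_le)
    thus False using s \<open>c *\<^sub>R a \<in> P\<close> by simp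
  qed
  moreover have "c *\<^sub>R (a - pairing w a *\<^sub>R v) \<in> P" using P a by blast
  hence "p + (s - pairing w p) *\<^sub>R v \<in> P" using s by (simp add: scaleR_diff_right c algebra_simps)
  ultimately show ?thesis by blast
qed

lemma leftmost_half_shear:
  assumes "leftmost P v p"
  shows "p \<in> half_shear P w v"
  unfolding half_shear_def using leftmost_shift [OF assms] assms
  by (auto simp: leftmost_def intro!: exI [of _ 0])

lemma half_shear_leftmost:
  assumes "p \<in> half_shear P w v"
  shows "\<exists>t\<ge>0. leftmost P v (p - t *\<^sub>R v)"
proof -
  obtain t where t: "0 \<le> t" "p - t *\<^sub>R v \<in> P" using assms by (auto simp: half_shear_def)
  then obtain s where "0 \<le> s" "leftmost P v (p - t *\<^sub>R v - s *\<^sub>R v)" using leftmost_exists by blast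
  thus ?thesis using t by (intro exI [of _ "t + s"]) (simp add: algebra_simps)
qed

text \<open>If a convex combination of vertices with positive weights cannot be moved to the left inside
  \<open>P\<close>, neither can any of these vertices.\<close>

lemma leftmost_hull:
  assumes "leftmost P v p"
  shows "p \<in> convex hull {x. x extreme_point_of P \<and> leftmost P v x}"
proof -
  define V where "V = {x. x extreme_point_of P}"
  have fin: "finite V"
    using fano unfolding V_def fano_polygon_def
    by (intro finite_polyhedron_extreme_points polytope_imp_polyhedron) simp
  have P: "P = convex hull V"
    unfolding V_def by (intro Krein_Milman_Minkowski fano_compact fano_convex fano)
  have "p \<in> convex hull V" using assms P by (simp add: leftmost_def)
  then obtain c where c: "\<And>x. x \<in> V \<Longrightarrow> 0 \<le> c x" "sum c V = 1" "(\<Sum>x\<in>V. c x *\<^sub>R x) = p"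
    unfolding convex_hull_finite [OF fin] by blast
  have left: "leftmost P v x" if x: "x \<in> V" "c x \<noteq> 0" for x
    unfolding leftmost_def
  proof (intro conjI allI impI notI)
    show "x \<in> P" using x by (auto simp: V_def extreme_point_of_def)
    fix t :: real assume t: "0 < t" "x - t *\<^sub>R v \<in> P"
    \<comment> \<open>moving the vertex \<open>x\<close> to the left moves the whole combination to the left\<close>
    define f where "f y = (if y = x then x - t *\<^sub>R v else y)" for y
    have "(\<Sum>y\<in>V. c y *\<^sub>R f y) \<in> P"
      using fin c t by (intro convex_sum fano_convex fano) (auto simp: f_def V_def extreme_point_of_def)
    also have "(\<Sum>y\<in>V. c y *\<^sub>R f y) = (\<Sum>y\<in>V. c y *\<^sub>R y - (if y = x then (c x * t) *\<^sub>R v else 0))"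
      by (intro sum.cong) (auto simp: f_def algebra_simps)
    also have "\<dots> = p - (c x * t) *\<^sub>R v" using fin x by (simp add: sum_subtractf c)
    finally have "p - (c x * t) *\<^sub>R v \<in> P" .
    moreover have "0 < c x * t" using t x c(1) [OF x(1)] by simp
    ultimately show False using assms by (auto simp: leftmost_def)
  qed
  define W where "W = {x \<in> V. c x \<noteq> 0}"
  have "finite W" using fin by (simp add: W_def)
  have "sum c W = 1" "(\<Sum>x\<in>W. c x *\<^sub>R x) = p"
    unfolding c(2,3) [symmetric] W_def by (intro sum.mono_neutral_left fin; auto)+
  moreover have "W \<subseteq> {x. x extreme_point_of P \<and> leftmost P v x}" using left by (auto simp: W_def V_def)
  ultimately show ?thesis
    using \<open>finite W\<close> c(1) convex_sum [OF \<open>finite W\<close> convex_convex_hull, of c "\<lambda>x. x"]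
    by (metis (no_types, lifting) W_def hull_inc mem_Collect_eq subsetD)
qed

text \<open>A point of the half shear lies between a left end point of \<open>P\<close> and a sheared right end point,
  and each of these is a convex combination of vertices of its own kind.\<close>

lemma half_shear_hull:
  "half_shear P w v = convex hull ({x. x extreme_point_of P \<and> leftmost P v x} \<union>
     shear w v ` {x. x extreme_point_of P \<and> leftmost P (- v) x})" (is "_ = convex hull (?L \<union> shear w v ` ?R)")
proof
  interpret opp: wide_polygon P w "- v" by (rule opposite)
  show "half_shear P w v \<subseteq> convex hull (?L \<union> shear w v ` ?R)"
  proof
    fix p assume p: "p \<in> half_shear P w v"
    obtain t where t: "0 \<le> t" "leftmost P v (p - t *\<^sub>R v)" using half_shear_leftmost [OF p] by blast
    have "p - t *\<^sub>R v \<in> convex hull ?L" using leftmost_hull [OF t(2)] .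
    hence l: "p - t *\<^sub>R v \<in> convex hull (?L \<union> shear w v ` ?R)" using hull_mono [of ?L] by blast
    obtain q where q: "q \<in> half_shear P w (- v)" "p = shear w v q"
      using p half_shear_uminus [OF wv] by (metis imageE)
    obtain s where s: "0 \<le> s" "leftmost P (- v) (q - s *\<^sub>R (- v))" using opp.half_shear_leftmost [OF q(1)] by blast
    have "q + s *\<^sub>R v \<in> convex hull ?R" using opp.leftmost_hull [OF s(2)] by simp
    hence "shear w v (q + s *\<^sub>R v) \<in> convex hull (shear w v ` ?R)"
      unfolding convex_hull_linear_image [OF linear_shear, symmetric] by (rule imageI)
    moreover have "shear w v (q + s *\<^sub>R v) = p + s *\<^sub>R v" by (simp add: q shear_def pairing_linear wv)
    ultimately have r: "p + s *\<^sub>R v \<in> convex hull (?L \<union> shear w v ` ?R)"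
      using hull_mono [of "shear w v ` ?R"] by (metis (no_types, lifting) Un_upper2 subsetD)
    have "p \<in> closed_segment (p - t *\<^sub>R v) (p - t *\<^sub>R v + (t + s) *\<^sub>R v)"
      using t s by (subst closed_segment_add_iff) (auto intro!: exI [of _ t])
    also have "p - t *\<^sub>R v + (t + s) *\<^sub>R v = p + s *\<^sub>R v" by (simp add: algebra_simps)
    finally show "p \<in> convex hull (?L \<union> shear w v ` ?R)"
      using closed_segment_subset [OF l r convex_convex_hull] by blast
  qed
  have "?L \<subseteq> half_shear P w v" using leftmost_half_shear by blast
  moreover have "shear w v ` ?R \<subseteq> half_shear P w v"
    using opp.leftmost_half_shear half_shear_uminus [OF wv] by blast
  ultimately show "convex hull (?L \<union> shear w v ` ?R) \<subseteq> half_shear P w v"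
    by (intro hull_minimal convex_half_shear fano_convex fano) blast
qed

lemma fano_half_shear: "fano_polygon (half_shear P w v)"
  unfolding fano_polygon_def
proof (intro conjI allI impI)
  have "finite {x. x extreme_point_of P}"
    using fano unfolding fano_polygon_def
    by (intro finite_polyhedron_extreme_points polytope_imp_polyhedron) simp
  hence "finite ({x. x extreme_point_of P \<and> leftmost P v x} \<union>
     shear w v ` {x. x extreme_point_of P \<and> leftmost P (- v) x})"
    by (auto elim: rev_finite_subset)
  thus "polytope (half_shear P w v)" unfolding polytope_def using half_shear_hull by blast
next
  fix x assume "x extreme_point_of half_shear P w v"
  hence "x \<in> {x. x extreme_point_of P \<and> leftmost P v x} \<union>
     shear w v ` {x. x extreme_point_of P \<and> leftmost P (- v) x}"
    unfolding half_shear_hull by (rule extreme_point_of_convex_hull)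
  thus "primitive_N x"
    using fano primitive_N_shear [OF _ v_lattice wv] unfolding fano_polygon_def by blast
next
  have z: "0 \<in> interior P" using fano by (simp add: fano_polygon_def)
  have lin: "linear (shear w (- v))" by (rule linear_shear)
  let ?U = "interior P \<inter> shear w (- v) -` interior P"
  have "open ?U"
    using linear_continuous_on [of "shear w (- v)" UNIV] lin
    by (intro open_Int open_interior open_vimage) (auto simp: linear_conv_bounded_linear)
  moreover have "0 \<in> ?U" using z linear_0 [OF lin] by simp
  moreover have "?U \<subseteq> half_shear P w v"
  proof
    fix p assume "p \<in> ?U"
    hence "p \<in> P" "p - pairing w p *\<^sub>R v \<in> P" using interior_subset [of P] by (auto simp: shear_def)
    thus "p \<in> half_shear P w v" unfolding half_shear_def by (intro CollectI conjI exI [of _ 0]) auto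
  qed
  ultimately show "0 \<in> interior (half_shear P w v)" by (rule interiorI)
qed

end

section \<open>A mutation is a half shear\<close>

lemma dilate_eq: "0 \<le> k \<Longrightarrow> x \<in> dilate k v \<longleftrightarrow> (\<exists>s. 0 \<le> s \<and> s \<le> of_int k \<and> x = s *\<^sub>R v)"
proof -
  assume k: "0 \<le> k"
  have "dilate k v = convex hull {0, of_int k *\<^sub>R v}"
    unfolding dilate_def by (simp add: convex_hull_scaling [symmetric])
  also have "\<dots> = closed_segment 0 (0 + of_int k *\<^sub>R v)" by (simp add: segment_convex_hull)
  finally show ?thesis using k by (simp only: closed_segment_add_iff of_int_0_le_iff) simp
qed

lemma dilateI: "0 \<le> s \<Longrightarrow> s \<le> of_int k \<Longrightarrow> s *\<^sub>R v \<in> dilate k v"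
  using dilate_eq [of k "s *\<^sub>R v" v] by (metis of_int_0_le_iff order_trans)

lemma plus_dilateI:
  "g \<in> A \<Longrightarrow> 0 \<le> s \<Longrightarrow> s \<le> of_int k \<Longrightarrow> g + s *\<^sub>R v \<in> A + dilate k v"
  by (intro set_plus_intro dilateI)

lemma plus_dilateE:
  assumes "x \<in> A + dilate k v" "0 \<le> k"
  obtains g s where "g \<in> A" "0 \<le> s" "s \<le> of_int k" "x = g + s *\<^sub>R v"
  using assms dilate_eq [OF assms(2)] by (metis set_plus_elim)

lemma slice_subset:
  assumes "convex P"
  shows "slice P w h \<subseteq> P \<inter> {p. pairing w p = of_int h}"
  unfolding slice_def
proof (rule hull_minimal)
  have "convex {p. (of_int (fst w), of_int (snd w)) \<bullet> p = of_int h}" by (rule convex_hyperplane)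
  thus "convex (P \<inter> {p. pairing w p = of_int h})"
    unfolding pairing_inner by (rule convex_Int [OF assms])
qed auto

lemma slice_inc: "p \<in> P \<Longrightarrow> p \<in> lattice_N \<Longrightarrow> pairing w p = of_int h \<Longrightarrow> p \<in> slice P w h"
  unfolding slice_def by (rule hull_inc) simp

lemma h_min_max:
  assumes "fano_polygon P" "p \<in> P" "pairing w p = of_int h"
  shows "h_min P w \<le> h" "h \<le> h_max P w"
proof -
  have "compact (pairing w ` P)"
    by (intro compact_continuous_image continuous_intros fano_compact assms)
  hence b: "bounded (pairing w ` P)" by (rule compact_imp_bounded)
  have "(INF v\<in>P. pairing w v) \<le> of_int h"
    unfolding assms(3) [symmetric] using b assms(2) by (intro cINF_lower bounded_imp_bdd_below)
  thus "h_min P w \<le> h" unfolding h_min_def by linarith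
  have "of_int h \<le> (SUP v\<in>P. pairing w v)"
    unfolding assms(3) [symmetric] using b assms(2) by (intro cSUP_upper bounded_imp_bdd_above)
  thus "h \<le> h_max P w" unfolding h_max_def by linarith
qed

text \<open>The data of a mutation at the lowest level already provide a segment in the bottom edge that
  is as long as the edge is high.\<close>

lemma mutation_data_wide_polygon:
  assumes "fano_polygon P" "mutation_data P w v G"
  shows "wide_polygon P w v"
proof
  obtain E where E: "E \<in> edges P" "w = inner_normal P E" using assms(2) unfolding mutation_data_def by blast
  then have w: "primitive_M w" "E = min_face P w" using edge_min_face [OF assms(1)] by metis+
  note face = min_face_face_of [OF assms(1), of w]
  have "polytope (min_face P w)"
    using face_of_polytope_polytope [OF _ face] assms(1) by (simp add: fano_polygon_def)
  then obtain x where x: "x extreme_point_of min_face P w"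
    using extreme_point_exists_convex [of "min_face P w"] min_face_nonempty [OF assms(1)]
      polytope_imp_compact polytope_imp_convex by metis
  hence xP: "x extreme_point_of P" and xF: "x \<in> min_face P w" using extreme_point_of_face [OF face] by auto
  obtain h where h: "pairing w x = of_int h"
    using pairing_lattice fano_extreme_lattice [OF assms(1) xP] by blast
  have "h < 0" using min_face_neg [OF assms(1) primitive_M_nonzero [OF w(1)] xF] h by simp
  moreover have "h_min P w \<le> h" using h_min_max [OF assms(1) _ h] xF min_face_subset by blast
  ultimately have "x \<in> G h + dilate \<bar>h\<bar> v" "G h + dilate \<bar>h\<bar> v \<subseteq> slice P w h"
    using assms(2) xP h unfolding mutation_data_def by auto
  hence "x \<in> G h + dilate \<bar>h\<bar> v" and Gsub: "G h + dilate \<bar>h\<bar> v \<subseteq> P \<inter> {p. pairing w p = of_int h}"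
    using slice_subset [OF fano_convex [OF assms(1)], of w h] by blast+
  then obtain g where g: "g \<in> G h" by (blast elim: set_plus_elim)
  have sub: "g + s *\<^sub>R v \<in> P \<inter> {p. pairing w p = of_int h}" if "0 \<le> s" "s \<le> of_int \<bar>h\<bar>" for s
    using Gsub plus_dilateI [OF g that] by blast
  have "g \<in> P" "pairing w g = of_int h" using sub [of 0] by auto
  moreover have "g + of_int \<bar>h\<bar> *\<^sub>R v \<in> P" using sub [of "of_int \<bar>h\<bar>"] by auto
  ultimately have "g \<in> min_face P w" "g - pairing w g *\<^sub>R v \<in> P"
    using \<open>h < 0\<close> h min_face_eq [OF xF] by auto
  thus "\<exists>a\<in>min_face P w. a - pairing w a *\<^sub>R v \<in> P" by blast
  show "primitive_M w" by (rule w)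
  show "primitive_N v" "pairing w v = 0" using assms(2) by (auto simp: mutation_data_def)
qed (rule assms)

lemma finite_lattice_bounded:
  assumes "bounded P"
  shows "finite (P \<inter> lattice_N)"
proof -
  obtain B where B: "\<And>p. p \<in> P \<Longrightarrow> norm p \<le> B" using assms by (auto simp: bounded_iff)
  let ?Z = "of_int ` {- \<lceil>B\<rceil>..\<lceil>B\<rceil>} :: real set"
  have "P \<inter> lattice_N \<subseteq> ?Z \<times> ?Z"
  proof
    fix p assume p: "p \<in> P \<inter> lattice_N"
    then obtain a b :: int where ab: "p = (of_int a, of_int b)"
      by (auto simp: lattice_N_def elim!: Ints_cases)
    have "\<bar>of_int a\<bar> \<le> B" "\<bar>of_int b\<bar> \<le> B"
      using B [of p] p norm_fst_le [of p] norm_snd_le [of p] ab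
      by (metis IntD1 dual_order.trans fst_conv real_norm_def snd_conv norm_fst_le norm_snd_le)+
    hence "\<bar>a\<bar> \<le> \<lceil>B\<rceil>" "\<bar>b\<bar> \<le> \<lceil>B\<rceil>" by linarith+
    hence "a \<in> {- \<lceil>B\<rceil>..\<lceil>B\<rceil>}" "b \<in> {- \<lceil>B\<rceil>..\<lceil>B\<rceil>}" by auto
    thus "p \<in> ?Z \<times> ?Z" unfolding ab by blast
  qed
  thus ?thesis by (rule finite_subset) simp
qed

context wide_polygon
begin

text \<open>A vertex that could be moved both to the left and to the right would be interior to a segment in \<open>P\<close>.\<close>

lemma extreme_leftmost_cases:
  assumes "x extreme_point_of P"
  shows "leftmost P v x \<or> leftmost P (- v) x"
proof (rule ccontr)
  assume "\<not> ?thesis"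
  moreover have x: "x \<in> P" using assms by (simp add: extreme_point_of_def)
  ultimately obtain s t where st: "0 < s" "x - s *\<^sub>R v \<in> P" "0 < t" "x + t *\<^sub>R v \<in> P"
    by (auto simp: leftmost_def)
  have eq: "x - s *\<^sub>R v + (s + t) *\<^sub>R v = x + t *\<^sub>R v" by (simp add: algebra_simps)
  have "x \<in> closed_segment (x - s *\<^sub>R v) (x - s *\<^sub>R v + (s + t) *\<^sub>R v)"
    using st by (subst closed_segment_add_iff) (auto intro!: exI [of _ s])
  hence "x \<in> closed_segment (x - s *\<^sub>R v) (x + t *\<^sub>R v)" unfolding eq .
  hence "x \<in> open_segment (x - s *\<^sub>R v) (x + t *\<^sub>R v)"
    using st v_nonzero by (simp add: open_segment_def)
  thus False using assms st by (auto simp: extreme_point_of_def)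
qed

text \<open>At a negative level \<open>h\<close> the condition \<open>G h + \<bar>h\<bar> F \<subseteq> P\<close> forces a left vertex of \<open>P\<close> to be a point of
  \<open>G h\<close>, and a right vertex to be the end of a translate of \<open>\<bar>h\<bar> F\<close> that starts in \<open>G h\<close>. So \<open>G h\<close>
  contains the first and the sheared image of the second, which are the points that span the half
  shear.\<close>

lemma mut_eq_half_shear:
  assumes "mutation_data P w v G"
  shows "mut P w v G = half_shear P w v"
proof
  have cvx: "convex P" using fano_convex [OF fano] .
  have G: "{p. p extreme_point_of P \<and> pairing w p = of_int h} \<subseteq> G h + dilate \<bar>h\<bar> v"
    and GP: "\<And>g s. g \<in> G h \<Longrightarrow> 0 \<le> s \<Longrightarrow> s \<le> of_int \<bar>h\<bar> \<Longrightarrow> g + s *\<^sub>R v \<in> P \<and> pairing w (g + s *\<^sub>R v) = of_int h"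
    if "h_min P w \<le> h" "h < 0" for h
  proof -
    show "{p. p extreme_point_of P \<and> pairing w p = of_int h} \<subseteq> G h + dilate \<bar>h\<bar> v"
      using assms that unfolding mutation_data_def by auto
    fix g and s :: real assume gs: "g \<in> G h" "0 \<le> s" "s \<le> of_int \<bar>h\<bar>"
    hence "g + s *\<^sub>R v \<in> G h + dilate \<bar>h\<bar> v" by (intro plus_dilateI)
    hence "g + s *\<^sub>R v \<in> slice P w h" using assms that unfolding mutation_data_def by auto
    thus "g + s *\<^sub>R v \<in> P \<and> pairing w (g + s *\<^sub>R v) = of_int h" using slice_subset [OF cvx] by blast
  qed
  show "mut P w v G \<subseteq> half_shear P w v"
    unfolding mut_def
  proof (intro hull_minimal convex_half_shear cvx subsetI)
    fix p assume "p \<in> (\<Union>h\<in>{h_min P w..-1}. G h) \<union> (\<Union>h\<in>{0..h_max P w}. slice P w h + dilate h v)"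
    then consider h where "h_min P w \<le> h" "h < 0" "p \<in> G h"
      | h where "0 \<le> h" "p \<in> slice P w h + dilate h v" by force
    thus "p \<in> half_shear P w v"
    proof cases
      case 1
      have "p \<in> P" "pairing w p = of_int h" "p + of_int \<bar>h\<bar> *\<^sub>R v \<in> P"
        using GP [OF 1, of 0] GP [OF 1, of "of_int \<bar>h\<bar>"] by auto
      thus ?thesis using 1 unfolding half_shear_def by (intro CollectI conjI exI [of _ 0]) auto
    next
      case 2
      then obtain q s where q: "q \<in> slice P w h" and s: "0 \<le> s" "s \<le> of_int h" and p: "p = q + s *\<^sub>R v"
        by (metis plus_dilateE)
      have "q \<in> P" "pairing w q = of_int h" using q slice_subset [OF cvx] by blast+
      moreover have "p + (of_int h - s - pairing w p) *\<^sub>R v = q"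
        using \<open>pairing w q = of_int h\<close> by (simp add: p pairing_shift algebra_simps)
      ultimately have "p + (of_int h - s - pairing w p) *\<^sub>R v \<in> P" by metis
      moreover have "p - s *\<^sub>R v \<in> P" using \<open>q \<in> P\<close> p by simp
      moreover have "0 \<le> of_int h - s" using s by simp
      ultimately show ?thesis using s(1) unfolding half_shear_def by blast
    qed
  qed
  have vertex: "\<exists>h. pairing w x = of_int h \<and> h_min P w \<le> h \<and> h \<le> h_max P w \<and> x \<in> slice P w h"
    if x: "x extreme_point_of P" for x
  proof -
    have "x \<in> P" "x \<in> lattice_N" using x fano_extreme_lattice [OF fano] by (auto simp: extreme_point_of_def)
    thus ?thesis using pairing_lattice h_min_max [OF fano] slice_inc by metis
  qed
  show "half_shear P w v \<subseteq> mut P w v G"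
    unfolding half_shear_hull mut_def
  proof (intro hull_mono Un_least subsetI)
    fix x assume "x \<in> {x. x extreme_point_of P \<and> leftmost P v x}"
    hence x: "x extreme_point_of P" "leftmost P v x" by auto
    obtain h where h: "pairing w x = of_int h" "h_min P w \<le> h" "h \<le> h_max P w" "x \<in> slice P w h"
      using vertex [OF x(1)] by blast
    show "x \<in> (\<Union>h\<in>{h_min P w..-1}. G h) \<union> (\<Union>h\<in>{0..h_max P w}. slice P w h + dilate h v)"
    proof (cases "h < 0")
      case True
      have "x \<in> G h + dilate \<bar>h\<bar> v" using G [OF h(2) True] x(1) h(1) by blast
      then obtain g s where g: "g \<in> G h" "0 \<le> s" "s \<le> of_int \<bar>h\<bar>" "x = g + s *\<^sub>R v"
        using plus_dilateE abs_ge_zero by metis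
      have "x - s *\<^sub>R v \<in> P" using GP [OF h(2) True g(1), of 0] g(4) by simp
      hence "s = 0" using x(2) g(2) by (auto simp: leftmost_def less_eq_real_def)
      thus ?thesis using g h(2) True by auto
    next
      case False
      hence "x + 0 *\<^sub>R v \<in> slice P w h + dilate h v" using h(4) by (intro plus_dilateI) auto
      thus ?thesis using False h(3) by auto
    qed
  next
    fix y assume "y \<in> shear w v ` {x. x extreme_point_of P \<and> leftmost P (- v) x}"
    then obtain x where x: "x extreme_point_of P" "leftmost P (- v) x" "y = shear w v x" by auto
    obtain h where h: "pairing w x = of_int h" "h_min P w \<le> h" "h \<le> h_max P w" "x \<in> slice P w h"
      using vertex [OF x(1)] by blast
    have y: "y = x + of_int h *\<^sub>R v" by (simp add: x shear_def h)
    show "y \<in> (\<Union>h\<in>{h_min P w..-1}. G h) \<union> (\<Union>h\<in>{0..h_max P w}. slice P w h + dilate h v)"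
    proof (cases "h < 0")
      case True
      have "x \<in> G h + dilate \<bar>h\<bar> v" using G [OF h(2) True] x(1) h(1) by blast
      then obtain g s where g: "g \<in> G h" "0 \<le> s" "s \<le> of_int \<bar>h\<bar>" "x = g + s *\<^sub>R v"
        using plus_dilateE abs_ge_zero by metis
      have "x - (of_int \<bar>h\<bar> - s) *\<^sub>R (- v) \<in> P"
        using GP [OF h(2) True g(1), of "of_int \<bar>h\<bar>"] g(4) by (simp add: algebra_simps)
      hence "s = of_int \<bar>h\<bar>" using x(2) g(3) unfolding leftmost_def by (metis diff_gt_0_iff_gt less_eq_real_def)
      hence "y = g" using True by (simp add: y g(4) algebra_simps)
      thus ?thesis using g h(2) True by auto
    next
      case False
      hence "y \<in> slice P w h + dilate h v" unfolding y using h(4) by (intro plus_dilateI) auto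
      thus ?thesis using False h(3) by auto
    qed
  qed
qed

text \<open>The largest possible choice of the polytopes \<open>G h\<close> works, since every vertex at a negative
  level is an end point of a horizontal segment of sufficient length.\<close>

lemma mutation_data_exists: "\<exists>G. mutation_data P w v G"
proof -
  interpret opp: wide_polygon P w "- v" by (rule opposite)
  have cvx: "convex P" using fano_convex [OF fano] .
  define S where "S h = {p \<in> P \<inter> lattice_N. pairing w p = of_int h \<and> p + of_int \<bar>h\<bar> *\<^sub>R v \<in> P}" for h
  have "mutation_data P w v (\<lambda>h. convex hull S h)"
    unfolding mutation_data_def
  proof (intro conjI ballI prim_v wv)
    obtain a where a: "a \<in> min_face P w" "a - pairing w a *\<^sub>R v \<in> P" using wide by blast
    have b: "a - pairing w a *\<^sub>R v \<in> min_face P w" using a by (simp add: min_face_eq [OF a(1)] pairing_shift)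
    have "a \<noteq> a - pairing w a *\<^sub>R v"
      using min_face_neg [OF fano primitive_M_nonzero [OF prim_w] a(1)] v_nonzero by auto
    thus "\<exists>E\<in>edges P. w = inner_normal P E"
      using min_face_edge [OF fano prim_w a(1) b] inner_normal_min_face [OF fano prim_w a(1) b] by metis
  next
    fix h assume h: "h \<in> {h_min P w..<0}"
    have "finite (S h)"
      by (rule finite_subset [OF _ finite_lattice_bounded [OF fano_bounded [OF fano]]]) (auto simp: S_def)
    thus "lattice_polytope (convex hull S h)"
      unfolding lattice_polytope_def by (intro exI [of _ "S h"]) (auto simp: S_def)
    show "{p. p extreme_point_of P \<and> pairing w p = of_int h} \<subseteq> convex hull S h + dilate \<bar>h\<bar> v"
    proof
      fix x assume "x \<in> {p. p extreme_point_of P \<and> pairing w p = of_int h}"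
      hence x: "x extreme_point_of P" "pairing w x = of_int h" by auto
      have xP: "x \<in> P" "x \<in> lattice_N" using x fano_extreme_lattice [OF fano] by (auto simp: extreme_point_of_def)
      have conv: "x + s *\<^sub>R z \<in> P" if "x + (t + s) *\<^sub>R z \<in> P" "0 \<le> t" "0 \<le> s" for s t z
      proof -
        have "x + s *\<^sub>R z \<in> closed_segment x (x + (t + s) *\<^sub>R z)"
          using that by (subst closed_segment_add_iff) auto
        thus ?thesis using closed_segment_subset [OF xP(1) that(1) cvx] by blast
      qed
      have hh: "of_int \<bar>h\<bar> = - real_of_int h" using h by simp
      consider "leftmost P v x" | "leftmost P (- v) x" using extreme_leftmost_cases [OF x(1)] by blast
      thus "x \<in> convex hull S h + dilate \<bar>h\<bar> v"
      proof cases
        case 1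
        obtain t where "0 \<le> t" "x + (t + of_int \<bar>h\<bar>) *\<^sub>R v \<in> P"
          using leftmost_shift [OF 1] x(2) h by auto
        hence "x + of_int \<bar>h\<bar> *\<^sub>R v \<in> P" using conv by simp
        hence "x \<in> convex hull S h" using xP x by (intro hull_inc) (simp add: S_def)
        hence "x + 0 *\<^sub>R v \<in> convex hull S h + dilate \<bar>h\<bar> v" by (intro plus_dilateI) auto
        thus ?thesis by simp
      next
        case 2
        obtain t where t: "0 \<le> t" "x + (t + of_int \<bar>h\<bar>) *\<^sub>R (- v) \<in> P"
          using opp.leftmost_shift [OF 2] x(2) unfolding hh by auto
        hence "x + of_int \<bar>h\<bar> *\<^sub>R (- v) \<in> P" using conv [OF t(2,1)] by simp
        hence "x - of_int \<bar>h\<bar> *\<^sub>R v \<in> P" by simp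
        moreover have "x - of_int \<bar>h\<bar> *\<^sub>R v \<in> lattice_N"
          by (intro lattice_N_diff lattice_N_scaleR xP v_lattice) simp
        ultimately have "x - of_int \<bar>h\<bar> *\<^sub>R v \<in> convex hull S h"
          using xP x by (intro hull_inc) (simp add: S_def pairing_shift)
        hence "x - of_int \<bar>h\<bar> *\<^sub>R v + of_int \<bar>h\<bar> *\<^sub>R v \<in> convex hull S h + dilate \<bar>h\<bar> v"
          by (intro plus_dilateI) auto
        thus ?thesis by simp
      qed
    qed
    have "dilate \<bar>h\<bar> v = convex hull {0, of_int \<bar>h\<bar> *\<^sub>R v}"
      unfolding dilate_def by (simp add: convex_hull_scaling [symmetric])
    hence "convex hull S h + dilate \<bar>h\<bar> v = convex hull (S h + {0, of_int \<bar>h\<bar> *\<^sub>R v})"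
      by (simp add: convex_hull_set_plus)
    also have "\<dots> \<subseteq> slice P w h"
      unfolding slice_def
    proof (intro hull_mono subsetI)
      fix p assume "p \<in> S h + {0, of_int \<bar>h\<bar> *\<^sub>R v}"
      then obtain q where q: "q \<in> S h" "p = q \<or> p = q + of_int \<bar>h\<bar> *\<^sub>R v" by (auto elim!: set_plus_elim)
      have "q + of_int \<bar>h\<bar> *\<^sub>R v \<in> lattice_N"
        using q(1) by (intro lattice_N_add lattice_N_scaleR v_lattice) (auto simp: S_def)
      thus "p \<in> {v \<in> P \<inter> lattice_N. pairing w v = of_int h}" using q by (auto simp: S_def pairing_shift)
    qed
    finally show "convex hull S h + dilate \<bar>h\<bar> v \<subseteq> slice P w h" .
  qed
  thus ?thesis by (intro exI)
qed

end

section \<open>The T-cones of a mutation\<close>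

text \<open>The piecewise linear map of the dual lattice that is induced by the shear of one half; it is also
  the effect of a seed mutation on the images of the basis vectors other than the mutated one.\<close>

definition half_shear_M :: "int \<times> int \<Rightarrow> int \<times> int \<Rightarrow> int \<times> int" where
  "half_shear_M w u = (fst u + max (u \<and>\<^sub>M w) 0 * fst w, snd u + max (u \<and>\<^sub>M w) 0 * snd w)"

lemma half_shear_M_wedge [simp]: "half_shear_M w u \<and>\<^sub>M w = u \<and>\<^sub>M w"
  by (simp add: half_shear_M_def wedge_def algebra_simps)

lemma inj_half_shear_M: "inj (half_shear_M w)"
proof (rule injI)
  fix x y assume eq: "half_shear_M w x = half_shear_M w y"
  hence "x \<and>\<^sub>M w = y \<and>\<^sub>M w" by (metis half_shear_M_wedge)
  thus "x = y" using eq by (simp add: half_shear_M_def prod_eq_iff)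
qed

text \<open>The map does not change \<open>u \<and> w\<close>, so the added multiple of \<open>w\<close> can be read off from the image and
  subtracted again.\<close>

lemma surj_half_shear_M: "\<exists>x. u = half_shear_M w x"
proof (intro exI)
  let ?m = "max (u \<and>\<^sub>M w) 0"
  have "(fst u - ?m * fst w, snd u - ?m * snd w) \<and>\<^sub>M w = u \<and>\<^sub>M w"
    by (simp add: wedge_def algebra_simps)
  thus "u = half_shear_M w (fst u - ?m * fst w, snd u - ?m * snd w)"
    by (simp add: half_shear_M_def)
qed

lemma half_shear_M_nonpos: "u \<and>\<^sub>M w \<le> 0 \<Longrightarrow> half_shear_M w u = u"
  by (simp add: half_shear_M_def max_def)

lemma half_shear_M_self [simp]: "half_shear_M w w = w" "half_shear_M w (- w) = - w"
  by (rule half_shear_M_nonpos, simp add: wedge_def)+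

text \<open>On the moved half the normals transform by the inverse transpose of the shear.\<close>

lemma pairing_half_shear_M:
  assumes "0 \<le> u \<and>\<^sub>M w"
  shows "pairing (half_shear_M w u) (shear w (perp w) p) = pairing u p"
proof -
  have m: "max (u \<and>\<^sub>M w) 0 = u \<and>\<^sub>M w" using assms by simp
  show ?thesis
    unfolding half_shear_M_def m
    by (simp add: shear_def pairing_def perp_def wedge_def algebra_simps)
qed

lemma primitive_half_shear_M:
  "primitive_M (half_shear_M w u) \<longleftrightarrow> primitive_M u"
proof -
  let ?m = "max (u \<and>\<^sub>M w) 0"
  have div: "g dvd fst u \<and> g dvd snd u \<longleftrightarrow> g dvd fst (half_shear_M w u) \<and> g dvd snd (half_shear_M w u)" for g
  proof -
    have A: "g dvd fst x \<and> g dvd snd x \<Longrightarrow> g dvd max (x \<and>\<^sub>M w) 0" for x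
      by (simp add: wedge_def max_def)
    show ?thesis
    proof
      assume "g dvd fst u \<and> g dvd snd u"
      with A [of u] show "g dvd fst (half_shear_M w u) \<and> g dvd snd (half_shear_M w u)"
        by (simp add: half_shear_M_def)
    next
      assume h: "g dvd fst (half_shear_M w u) \<and> g dvd snd (half_shear_M w u)"
      with A [of "half_shear_M w u"] have "g dvd ?m" by simp
      thus "g dvd fst u \<and> g dvd snd u" using h by (simp add: half_shear_M_def dvd_add_left_iff)
    qed
  qed
  show ?thesis unfolding primitive_M_def coprime_def using div by blast
qed

lemma T_count_shear_image:
  assumes "primitive_M u' \<longleftrightarrow> primitive_M u" "v \<in> lattice_N" "pairing w v = 0"
    and pair: "\<And>p. pairing u' (shear w v p) = pairing u p"
  shows "T_count (shear w v ` Q) u' = T_count Q u"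
proof -
  have inj: "inj (shear w v)" using inj_shear assms(3) .
  have face: "min_face (shear w v ` Q) u' = shear w v ` min_face Q u"
    unfolding min_face_def by (auto simp: pair simp del: split_paired_All split_paired_Ex)
  have "(shear w v ` F) \<inter> lattice_N = shear w v ` (F \<inter> lattice_N)" for F
    using shear_image_lattice [OF assms(2,3)] image_Int [OF inj] by metis
  hence "width (shear w v ` F) = width F" for F
    using inj by (simp add: width_def card_image inj_on_subset [OF inj])
  thus ?thesis unfolding T_count_def face by (simp add: assms(1) pair)
qed

context wide_polygon
begin

text \<open>A functional that increases in the direction \<open>v\<close> takes its minimum on a left end point, and
  the left end points of \<open>P\<close> and of the half shear are the same.\<close>

lemma min_face_half_shear:
  assumes "0 < pairing u v"
  shows "min_face (half_shear P w v) u = min_face P u"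
proof -
  obtain p where p: "p \<in> min_face P u" using min_face_nonempty [OF fano] by blast
  have left: "leftmost P v q" if "q \<in> min_face P u" for q
    unfolding leftmost_def
  proof (intro conjI allI impI notI)
    show "q \<in> P" using that by (simp add: min_face_def)
    fix t :: real assume "0 < t" "q - t *\<^sub>R v \<in> P"
    hence "pairing u q \<le> pairing u q - t * pairing u v"
      using that by (force simp: min_face_def pairing_linear)
    moreover have "0 < t * pairing u v" using \<open>0 < t\<close> assms by simp
    ultimately show False by simp
  qed
  have ge: "pairing u p \<le> pairing u q" "pairing u q = pairing u p \<Longrightarrow> q \<in> P"
    if q: "q \<in> half_shear P w v" for q
  proof -
    obtain t where t: "0 \<le> t" "q - t *\<^sub>R v \<in> P" using q by (auto simp: half_shear_def)
    hence le: "pairing u p \<le> pairing u q - t * pairing u v"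
      using p by (force simp: min_face_def pairing_linear)
    moreover have "0 \<le> t * pairing u v" using t assms by simp
    ultimately show "pairing u p \<le> pairing u q" by simp
    show "q \<in> P" if "pairing u q = pairing u p"
    proof -
      have "t * pairing u v \<le> 0" using le that by simp
      hence "t = 0" using t(1) assms by (simp add: mult_le_0_iff)
      thus ?thesis using t by simp
    qed
  qed
  have "min_face (half_shear P w v) u = {q \<in> half_shear P w v. pairing u q = pairing u p}"
    using left [OF p] ge(1) by (intro min_face_eqI [of p] leftmost_half_shear) auto
  also have "\<dots> = min_face P u"
    using ge(2) leftmost_half_shear [OF left] min_face_eq [OF p] by blast
  finally show ?thesis .
qed

text \<open>On a horizontal face, which lies at the level \<open>w(a)\<close>, the right end point is moved by \<open>w(a)\<close>, which
  is negative at the bottom and positive at the top.\<close>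

lemma min_face_half_shear_horizontal:
  assumes u: "pairing u v = 0" and F: "min_face P u = closed_segment a (a + k *\<^sub>R v)"
    and k: "0 \<le> k" "0 \<le> k + pairing w a"
  shows "min_face (half_shear P w v) u = closed_segment a (a + (k + pairing w a) *\<^sub>R v)"
proof -
  let ?c = "pairing w a"
  have a: "a \<in> min_face P u" unfolding F by simp
  have level: "pairing u (p + t *\<^sub>R v) = pairing u p" "pairing u (p - t *\<^sub>R v) = pairing u p" for p t
    by (simp_all add: pairing_linear u)
  have seg: "q \<in> P \<and> pairing u q = pairing u a \<longleftrightarrow> (\<exists>x. 0 \<le> x \<and> x \<le> k \<and> q = a + x *\<^sub>R v)" for q
    using closed_segment_add_iff [OF k(1), of q a v] min_face_eq [OF a] F by auto
  have eq: "q \<in> half_shear P w v \<and> pairing u q = pairing u a \<longleftrightarrow>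
      (\<exists>x. 0 \<le> x \<and> x \<le> k + ?c \<and> q = a + x *\<^sub>R v)" (is "?l \<longleftrightarrow> ?r") for q
  proof
    assume ?l
    then obtain t s where t: "0 \<le> t" "q - t *\<^sub>R v \<in> P" and s: "0 \<le> s" "q + (s - pairing w q) *\<^sub>R v \<in> P"
      and q: "pairing u q = pairing u a" by (auto simp: half_shear_def)
    obtain x where x: "0 \<le> x" "q - t *\<^sub>R v = a + x *\<^sub>R v" using seg [of "q - t *\<^sub>R v"] t q level by auto
    hence qa: "q = a + (x + t) *\<^sub>R v" by (simp add: algebra_simps)
    hence "pairing w q = ?c" by (simp add: pairing_shift)
    then obtain y where y: "y \<le> k" "q + (s - ?c) *\<^sub>R v = a + y *\<^sub>R v"
      using seg [of "q + (s - pairing w q) *\<^sub>R v"] s q level by auto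
    have "(x + t + s - ?c) *\<^sub>R v = y *\<^sub>R v" using y(2) unfolding qa by (simp add: algebra_simps)
    hence "x + t + s - ?c = y" using v_nonzero by simp
    thus ?r using qa x t s y by (intro exI [of _ "x + t"]) auto
  next
    assume ?r
    then obtain x where x: "0 \<le> x" "x \<le> k + ?c" "q = a + x *\<^sub>R v" by blast
    have q: "pairing w q = ?c" "pairing u q = pairing u a" unfolding x(3) level pairing_shift by simp_all
    have "q - x *\<^sub>R v \<in> P" using subsetD [OF min_face_subset a] unfolding x(3) by simp
    moreover have "q + ((k + ?c - x) - pairing w q) *\<^sub>R v = a + k *\<^sub>R v"
      unfolding q(1) unfolding x(3) by (simp add: algebra_simps)
    moreover have "a + k *\<^sub>R v \<in> P" using seg [of "a + k *\<^sub>R v"] k by blast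
    moreover have "0 \<le> k + ?c - x" using x by simp
    ultimately show ?l using q(2) x(1) unfolding half_shear_def by (metis (mono_tags, lifting) mem_Collect_eq)
  qed
  have "min_face (half_shear P w v) u = {q \<in> half_shear P w v. pairing u q = pairing u a}"
  proof (rule min_face_eqI [of a])
    have "\<exists>x. 0 \<le> x \<and> x \<le> k + ?c \<and> a = a + x *\<^sub>R v" using k by (intro exI [of _ 0]) simp
    thus "a \<in> half_shear P w v" using eq by blast
    fix q assume "q \<in> half_shear P w v"
    then obtain t where "q - t *\<^sub>R v \<in> P" by (auto simp: half_shear_def)
    hence "pairing u a \<le> pairing u (q - t *\<^sub>R v)" using a by (simp add: min_face_def)
    thus "pairing u a \<le> pairing u q" by (simp add: level)
  qed simp
  also have "\<dots> = closed_segment a (a + (k + ?c) *\<^sub>R v)"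
    using eq closed_segment_add_iff [OF k(2), of _ a v] by blast
  finally show ?thesis .
qed

lemma T_count_half_shear_right:
  "0 < pairing u v \<Longrightarrow> T_count (half_shear P w v) u = T_count P u"
  by (simp add: T_count_def min_face_half_shear)

end

locale mutable_polygon = wide_polygon P w "perp w" for P w

context mutable_polygon
begin

abbreviation mutated :: "(real \<times> real) set" where
  "mutated \<equiv> half_shear P w (perp w)"

text \<open>The case of a face on the right side is that of a face on the left side for the opposite
  direction, followed by the shear.\<close>

lemma T_count_mutated_generic:
  assumes "u \<and>\<^sub>M w \<noteq> 0"
  shows "T_count mutated (half_shear_M w u) = T_count P u"
proof (cases "u \<and>\<^sub>M w < 0")
  case True
  thus ?thesis using T_count_half_shear_right [of u] by (simp add: half_shear_M_nonpos pairing_perp)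
next
  case False
  hence pos: "0 < u \<and>\<^sub>M w" using assms by simp
  interpret opp: wide_polygon P w "- perp w" by (rule opposite)
  have "T_count (half_shear P w (- perp w)) u = T_count P u"
    using opp.T_count_half_shear_right [of u] pos
    by (simp add: pairing_perp flip: perp_uminus) (simp add: wedge_def)
  moreover have "T_count (shear w (perp w) ` half_shear P w (- perp w)) (half_shear_M w u)
      = T_count (half_shear P w (- perp w)) u"
    using pos by (intro T_count_shear_image primitive_half_shear_M v_lattice pairing_half_shear_M) auto
  ultimately show ?thesis by (simp add: half_shear_uminus)
qed

text \<open>The bottom edge is at the level \<open>- r\<close>, where \<open>r\<close> is its height, so its width drops by \<open>r\<close>. It is at
  least \<open>r\<close> by \<open>wide\<close>, hence the quotient drops by one.\<close>

lemma T_count_mutated_bottom: "T_count P w = Suc (T_count mutated w)"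
proof -
  obtain a k r where F: "a \<in> lattice_N" "0 < r" "pairing w a = - of_nat r"
    "min_face P w = closed_segment a (a + of_nat k *\<^sub>R perp w)"
    using min_face_segment [OF fano prim_w] by metis
  have a: "a \<in> min_face P w" unfolding F(4) by simp
  obtain b where b: "b \<in> min_face P w" "b - pairing w b *\<^sub>R perp w \<in> P" using wide by blast
  have wb: "pairing w b = - of_nat r" using b(1) F(3) by (simp add: min_face_eq [OF a])
  have b': "b + of_nat r *\<^sub>R perp w \<in> min_face P w"
    using b wb by (simp add: min_face_eq [OF b(1)] pairing_shift)
  obtain x where x: "0 \<le> x" "b = a + x *\<^sub>R perp w"
    using b(1) closed_segment_add_iff [of "of_nat k" b a "perp w"] unfolding F(4) by auto
  obtain y where y: "y \<le> of_nat k" "b + of_nat r *\<^sub>R perp w = a + y *\<^sub>R perp w"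
    using b' closed_segment_add_iff [of "of_nat k" "b + of_nat r *\<^sub>R perp w" a "perp w"] unfolding F(4) by auto
  have "(x + of_nat r) *\<^sub>R perp w = y *\<^sub>R perp w" using y(2) unfolding x(2) by (simp add: algebra_simps)
  hence "x + of_nat r = y" using v_nonzero by simp
  hence rk: "r \<le> k" using x(1) y(1) by linarith
  have "min_face mutated w = closed_segment a (a + (of_nat k + pairing w a) *\<^sub>R perp w)"
    using rk F by (intro min_face_half_shear_horizontal) auto
  also have "of_nat k + pairing w a = of_nat (k - r)" using rk F(3) by (simp add: of_nat_diff)
  finally have "T_count mutated w = (k - r) div r"
    by (intro T_count_segment [OF prim_w F(1) prim_v _ F(3)]) simp_all
  moreover have "T_count P w = k div r"
    by (intro T_count_segment [OF prim_w F(1) prim_v _ F(3,4)]) simp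
  ultimately show ?thesis using rk F(2) by (simp add: le_div_geq)
qed

text \<open>The top face, an edge or a vertex, is at the level of its height, and its width grows by that
  height.\<close>

lemma T_count_mutated_top: "T_count mutated (- w) = Suc (T_count P (- w))"
proof -
  have prim: "primitive_M (- w)" using prim_w by simp
  obtain b k r where F: "b \<in> lattice_N" "0 < r" "pairing (- w) b = - of_nat r"
    "min_face P (- w) = closed_segment b (b + of_nat k *\<^sub>R perp (- w))"
    using min_face_segment [OF fano prim] by metis
  define a where "a = b - of_nat k *\<^sub>R perp w"
  have aN: "a \<in> lattice_N" unfolding a_def by (intro lattice_N_diff lattice_N_scaleR F v_lattice) simp
  have wa: "pairing w a = of_nat r" "pairing (- w) a = - of_nat r"
    using F(3) by (simp_all add: a_def pairing_shift pairing_uminus)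
  have seg: "min_face P (- w) = closed_segment a (a + of_nat k *\<^sub>R perp w)"
    unfolding F(4) a_def by (simp add: closed_segment_commute)
  have u: "pairing (- w) (perp w) = 0" by (simp add: pairing_uminus)
  have "min_face mutated (- w) = closed_segment a (a + (of_nat k + pairing w a) *\<^sub>R perp w)"
    using wa(1) by (intro min_face_half_shear_horizontal u seg) auto
  also have "of_nat k + pairing w a = of_nat (k + r)" using wa(1) by simp
  finally have "T_count mutated (- w) = (k + r) div r"
    by (intro T_count_segment [OF prim aN prim_v u wa(2)])
  moreover have "T_count P (- w) = k div r"
    by (intro T_count_segment [OF prim aN prim_v u wa(2) seg])
  ultimately show ?thesis using F(2) by simp
qed

lemma T_count_mutated:
  "T_count mutated (half_shear_M w u) + (if u = w then 1 else 0) = T_count P u + (if u = - w then 1 else 0)"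
proof (cases "primitive_M u")
  case True
  have ww: "w \<noteq> - w" using primitive_M_nonzero [OF prim_w] by (auto simp: prod_eq_iff)
  consider "u \<and>\<^sub>M w \<noteq> 0" | "u = w" | "u = - w" using wedge_eq_0_primitive [OF True prim_w] by blast
  thus ?thesis
  proof cases
    case 1
    hence "u \<noteq> w" "u \<noteq> - w" by (auto simp: wedge_def)
    thus ?thesis using T_count_mutated_generic [OF 1] by simp
  next
    case 2
    thus ?thesis using T_count_mutated_bottom ww by simp
  next
    case 3
    thus ?thesis using T_count_mutated_top ww by simp
  qed
next
  case False
  hence "u \<noteq> w" "u \<noteq> - w" using prim_w by auto
  thus ?thesis using False by (simp add: T_count_def primitive_half_shear_M)
qed

text \<open>One copy of \<open>w\<close> is removed before the bijection is applied, which fixes \<open>w\<close> and \<open>- w\<close>.\<close>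

lemma T_cone_normals_mutated:
  assumes W: "\<And>u. count W u = T_count P u"
  shows "T_cone_normals mutated (image_mset (half_shear_M w) (W - {#w#}) + {#- w#})"
proof (rule T_cone_normalsI [OF fano_half_shear])
  fix u
  obtain x where x: "u = half_shear_M w x" using surj_half_shear_M by blast
  have "u = - w \<longleftrightarrow> x = - w" using x inj_half_shear_M [of w] by (metis half_shear_M_self(2) injD)
  moreover have "count (image_mset (half_shear_M w) (W - {#w#})) u = count (W - {#w#}) x"
  proof -
    have "half_shear_M w -` {u} = {x}" unfolding x using injD [OF inj_half_shear_M [of w]] by blast
    hence "count (image_mset (half_shear_M w) A) u = sum (count A) ({x} \<inter> set_mset A)" for A
      by (simp add: count_image_mset)
    also have "sum (count A) ({x} \<inter> set_mset A) = count A x" for A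
      by (cases "x \<in># A") (simp_all add: not_in_iff)
    finally show ?thesis .
  qed
  moreover have "1 \<le> T_count P w" using T_count_mutated_bottom by simp
  ultimately show "count (image_mset (half_shear_M w) (W - {#w#}) + {#- w#}) u = T_count mutated u"
    using T_count_mutated [of x] W by (auto simp: x)
qed

end

text \<open>Changing the sign of the direction changes the mutation by a shear.\<close>

lemma polygon_mutation_half_shear:
  assumes "fano_polygon P" "polygon_mutation P w P'"
  shows "mutable_polygon P w" "\<exists>g\<in>GL2Z. g ` P' = half_shear P w (perp w)"
proof -
  obtain v G where vG: "mutation_data P w v G" "P' = mut P w v G"
    using assms(2) by (auto simp: polygon_mutation_def)
  interpret wide_polygon P w v by (rule mutation_data_wide_polygon [OF assms(1) vG(1)])
  have P': "P' = half_shear P w v" using mut_eq_half_shear vG by simp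
  have id: "id \<in> GL2Z" by (simp add: GL2Z_def linear_id)
  consider "v = perp w" | "v = - perp w" using primitive_N_eq_perp [OF prim_w prim_v wv] by blast
  note sign = this
  thus "mutable_polygon P w"
    unfolding mutable_polygon_def using wide_polygon_axioms opposite by cases simp_all
  show "\<exists>g\<in>GL2Z. g ` P' = half_shear P w (perp w)"
    using sign
  proof cases
    case 1
    thus ?thesis using id P' by (intro bexI [of _ id]) simp_all
  next
    case 2
    have "perp w \<in> lattice_N" using lattice_N_uminus [OF v_lattice] 2 by simp
    hence "shear w (perp w) \<in> GL2Z" by (intro shear_GL2Z) auto
    moreover have "shear w (perp w) ` P' = half_shear P w (perp w)"
      unfolding P' 2 by (rule half_shear_uminus) simp
    ultimately show ?thesis by blast
  qed
qed

lemma mutable_polygon_mutation: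
  assumes "mutable_polygon P w"
  shows "polygon_mutation P w (half_shear P w (perp w))"
proof -
  interpret mutable_polygon P w by fact
  obtain G where "mutation_data P w (perp w) G" using mutation_data_exists by blast
  thus ?thesis using mut_eq_half_shear unfolding polygon_mutation_def by metis
qed

text \<open>A T-cone with normal \<open>w\<close> exists if and only if the edge is at least as wide as it is high, which
  is the geometric condition for a mutation.\<close>

lemma mutable_polygon_iff:
  assumes "fano_polygon P"
  shows "mutable_polygon P w \<longleftrightarrow> 0 < T_count P w"
proof
  assume "mutable_polygon P w"
  then interpret mutable_polygon P w .
  show "0 < T_count P w" using T_count_mutated_bottom by simp
next
  assume pos: "0 < T_count P w"
  hence w: "primitive_M w" by (simp add: T_count_def split: if_splits)
  obtain a k r where F: "a \<in> lattice_N" "0 < r" "pairing w a = - of_nat r"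
    "min_face P w = closed_segment a (a + of_nat k *\<^sub>R perp w)"
    using min_face_segment [OF assms w] by metis
  have "T_count P w = k div r"
    by (intro T_count_segment [OF w F(1) primitive_N_perp [OF w] _ F(3,4)]) simp
  hence rk: "r \<le> k" using pos by (simp add: div_greater_zero_iff)
  have "a - pairing w a *\<^sub>R perp w \<in> min_face P w"
    using rk unfolding F(4) F(3) closed_segment_add_iff [OF of_nat_0_le_iff]
    by (intro exI [of _ "of_nat r"]) simp
  hence "a - pairing w a *\<^sub>R perp w \<in> P" using min_face_subset by blast
  moreover have "a \<in> min_face P w" unfolding F(4) by simp
  ultimately have "wide_polygon P w (perp w)"
    using assms w primitive_N_perp by unfold_locales auto
  thus "mutable_polygon P w" by (simp add: mutable_polygon_def)
qed

lemma quiver_form_generators: "quiver_form w (frag_of k) (frag_of l) = w k \<and>\<^sub>M w l"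
  by (simp add: quiver_form_def arrows_def wedge_def max_def algebra_simps)

lemma additive_on_lattice_L:
  fixes \<pi> :: "(nat \<Rightarrow>\<^sub>0 int) \<Rightarrow> int \<times> int"
  assumes add: "\<And>u v. u \<in> lattice_L n \<Longrightarrow> v \<in> lattice_L n \<Longrightarrow> \<pi> (u + v) = \<pi> u + \<pi> v"
    and "i \<in> {1..n}"
  shows "\<pi> (- frag_of i) = - \<pi> (frag_of i)"
    and "\<pi> (frag_cmul (int m) (frag_of i)) = (int m * fst (\<pi> (frag_of i)), int m * snd (\<pi> (frag_of i)))"
proof -
  have L: "0 \<in> lattice_L n" "frag_cmul c (frag_of i) \<in> lattice_L n" for c
    using assms(2) keys_cmul [of c "frag_of i"] by (auto simp: lattice_L_def)
  have zero: "\<pi> 0 = 0" using add [OF L(1) L(1)] by simp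
  have "\<pi> (frag_of i + - frag_of i) = \<pi> (frag_of i) + \<pi> (- frag_of i)"
    using add [of "frag_of i" "- frag_of i"] L(2) [of 1] L(2) [of "- 1"] by simp
  thus "\<pi> (- frag_of i) = - \<pi> (frag_of i)" by (simp add: zero eq_neg_iff_add_eq_0 add.commute)
  show "\<pi> (frag_cmul (int m) (frag_of i)) = (int m * fst (\<pi> (frag_of i)), int m * snd (\<pi> (frag_of i)))"
  proof (induction m)
    case 0
    show ?case by (simp add: zero zero_prod_def)
  next
    case (Suc m)
    have "\<pi> (frag_cmul (int (Suc m)) (frag_of i)) = \<pi> (frag_of i + frag_cmul (int m) (frag_of i))"
      by (simp add: frag_cmul_distrib)
    also have "\<dots> = \<pi> (frag_of i) + \<pi> (frag_cmul (int m) (frag_of i))"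
      using add L(2) [of 1] L(2) [of "int m"] by simp
    finally show ?case using Suc by (simp add: prod_eq_iff algebra_simps)
  qed
qed

theorem proposition3p15:
  fixes P :: "(real \<times> real) set"
    and n :: nat
    and \<B> :: "(real \<times> real) set set list set"
    and \<T> :: "(real \<times> real) set set"
    and C :: "nat \<Rightarrow> (real \<times> real) set"
    and w :: "nat \<Rightarrow> int \<times> int"
    and e :: "nat \<Rightarrow> (nat \<Rightarrow>\<^sub>0 int)"
    and x :: "nat \<Rightarrow> funfield"
    and \<pi> :: "(nat \<Rightarrow>\<^sub>0 int) \<Rightarrow> int \<times> int"
  assumes "fano_polygon P"
    and "singularity_content P = (n, \<B>)"
    and "primitive_T_cones P \<T>"
    and "bij_betw C {1..n} \<T>"
    and "\<And>i. i \<in> {1..n} \<Longrightarrow> w i = inner_normal P (determined_edge P (C i))"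
    and "(e, x) = initial_seed"
    and "\<And>u v. u \<in> lattice_L n \<Longrightarrow> v \<in> lattice_L n \<Longrightarrow> \<pi> (u + v) = \<pi> u + \<pi> v"
    and "\<And>i. i \<in> {1..n} \<Longrightarrow> \<pi> (e i) = w i"
  shows "(\<forall>j\<in>{1..n}. \<forall>e' x'. (e', x') = seed_mutation (quiver_form w) n j (e, x) \<longrightarrow>
            (\<exists>P'. polygon_mutation P (w j) P' \<and>
               T_cone_normals P' {#\<pi> (e' i). i \<in># mset_set {1..n}#}) \<and>
            (\<forall>P'. polygon_mutation P (w j) P' \<longrightarrow>
               (\<exists>g\<in>GL2Z. T_cone_normals (g ` P') {#\<pi> (e' i). i \<in># mset_set {1..n}#}))) \<and>
         (\<forall>u P'. polygon_mutation P u P' \<longrightarrow> (\<exists>j\<in>{1..n}. u = w j))"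
proof (intro conjI ballI allI impI)
  define W where "W = {#w i. i \<in># mset_set {1..n}#}"
  have W: "count W u = T_count P u" for u
  proof -
    have "W = {#inner_normal P (determined_edge P (C i)). i \<in># mset_set {1..n}#}"
      unfolding W_def using assms(5) by (intro image_mset_cong) simp
    also have "\<dots> = {#inner_normal P (determined_edge P D). D \<in># image_mset C (mset_set {1..n})#}"
      by (simp add: multiset.map_comp comp_def)
    also have "image_mset C (mset_set {1..n}) = mset_set \<T>"
      using assms(4) by (simp add: bij_betw_def image_mset_mset_set)
    finally show ?thesis using primitive_T_cones_count(2) [OF assms(1,3)] by simp
  qed
  have in_W: "0 < T_count P u \<longleftrightarrow> (\<exists>j\<in>{1..n}. u = w j)" for u
    unfolding W [symmetric] count_greater_zero_iff by (auto simp: W_def)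
  have e: "e = frag_of" using assms(6) by (simp add: initial_seed_def)
  {
    fix u P' assume "polygon_mutation P u P'"
    thus "\<exists>j\<in>{1..n}. u = w j"
      using polygon_mutation_half_shear(1) mutable_polygon_iff in_W assms(1) by blast
  }
  fix j e' x' assume j: "j \<in> {1..n}" and seed: "(e', x') = seed_mutation (quiver_form w) n j (e, x)"
  interpret mutable_polygon P "w j" using mutable_polygon_iff [OF assms(1)] in_W j by blast
  have e': "e' k = (if k = j then - e j else e k + frag_cmul (max (w k \<and>\<^sub>M w j) 0) (e j))" for k
    using seed by (simp add: seed_mutation_def Let_def e quiver_form_generators)
  have pi_j: "\<pi> (e' j) = - w j"
    using additive_on_lattice_L(1) [of n \<pi>] assms(7,8) j by (simp add: e' e)
  have pi_k: "\<pi> (e' k) = half_shear_M (w j) (w k)" if k: "k \<in> {1..n} - {j}" for k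
  proof -
    let ?m = "nat (max (w k \<and>\<^sub>M w j) 0)"
    have "e' k = frag_of k + frag_cmul (int ?m) (frag_of j)" using k by (simp add: e' e)
    moreover have "frag_of k \<in> lattice_L n" "frag_cmul (int ?m) (frag_of j) \<in> lattice_L n"
      using k j keys_cmul [of "int ?m" "frag_of j"] by (auto simp: lattice_L_def)
    ultimately have "\<pi> (e' k) = \<pi> (frag_of k) + \<pi> (frag_cmul (int ?m) (frag_of j))" using assms(7) by simp
    also have "\<pi> (frag_cmul (int ?m) (frag_of j)) = (int ?m * fst (w j), int ?m * snd (w j))"
      using additive_on_lattice_L(2) [of n \<pi> j ?m] assms(7,8) [unfolded e] j by simp
    also have "\<pi> (frag_of k) = w k" using assms(8) [unfolded e] k by simp
    finally show ?thesis by (simp add: half_shear_M_def prod_eq_iff)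
  qed
  have split: "mset_set {1..n} = {#j#} + mset_set ({1..n} - {j})"
    using j by (simp add: mset_set.remove)
  have "W - {#w j#} = {#w i. i \<in># mset_set ({1..n} - {j})#}" unfolding W_def split by simp
  hence "image_mset (half_shear_M (w j)) (W - {#w j#}) = {#half_shear_M (w j) (w i). i \<in># mset_set ({1..n} - {j})#}"
    by (simp add: multiset.map_comp comp_def)
  also have "\<dots> = {#\<pi> (e' i). i \<in># mset_set ({1..n} - {j})#}"
    using pi_k by (intro image_mset_cong) simp
  finally have "image_mset (half_shear_M (w j)) (W - {#w j#}) + {#- w j#} = {#\<pi> (e' i). i \<in># mset_set {1..n}#}"
    unfolding split by (simp add: pi_j)
  hence normals: "T_cone_normals mutated {#\<pi> (e' i). i \<in># mset_set {1..n}#}"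
    using T_cone_normals_mutated [of W] W by simp
  show "\<exists>P'. polygon_mutation P (w j) P' \<and> T_cone_normals P' {#\<pi> (e' i). i \<in># mset_set {1..n}#}"
    using normals mutable_polygon_mutation [OF mutable_polygon_axioms] by blast
  show "\<exists>g\<in>GL2Z. T_cone_normals (g ` P') {#\<pi> (e' i). i \<in># mset_set {1..n}#}"
    if "polygon_mutation P (w j) P'" for P'
    using polygon_mutation_half_shear(2) [OF assms(1) that] normals by metis
qed

end
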